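(* Let $D_{r,n}$ be the number of descents of the permutation obtained after $r$ iterated random-to-top shuffles of an $n$-card deck, starting from the identity. (i) Let $c>0$ be a constant. Then, as $n\to\infty$, $$\frac{D_{\lfloor cn\rfloor,n}-n(1-e^{-c})/2}{\sqrt{n}}$$ converges in distribution to $\mathcal{N}\left(0,\frac{1+2e^{-c}-3(1+c)e^{-2c}}{12}\right)$. (ii) If $r=r(n)$ is a sequence of positive integers for which there exists a sequence $c_n\to\infty$ such that $r(n)\ge \frac{n\log n}{2}+c_n n$ for all sufficiently large $n$, then $$\frac{D_{r(n),n}-n/2}{\sqrt{n}}$$ converges in distribution to $\mathcal{N}(0,1/12)$ as $n\to\infty$.
   Context: A deck of $n$ cards labelled $1,\dots,n$ in some order is encoded by the permutation $\pi$ of $[n]=\{1,\dots,n\}$ where $\pi(i)$ is the card in position $i$ (position $1$ is the top). A random-to-top shuffle selects one of the $n$ cards uniformly at random (the top card may be selected) and moves it to the top, keeping the relative order of the other cards. Iterated random-to-top shuffles start from the deck in order $12\cdots n$ and perform the selections independently. A descent of $\pi$ is an index $i\in\{1,\dots,n-1\}$ with $\pi(i)>\pi(i+1)$. $\mathcal{N}(\mu,\sigma^2)$ denotes the normal distribution with mean $\mu$ and variance $\sigma^2$. *)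

theory Defs
  imports "HOL-Probability.Probability" "HOL-Combinatorics.Permutations"
begin

text \<open>
  A deck of \<open>n\<close> cards is a function \<open>\<pi>\<close> with \<open>\<pi> permutes {1..n}\<close>; \<open>\<pi> i\<close> is the card in
  position \<open>i\<close>, position \<open>1\<close> being the top. Hence \<open>inv \<pi> k\<close> is the position of card \<open>k\<close>.
\<close>

definition move_to_top :: "nat \<Rightarrow> (nat \<Rightarrow> nat) \<Rightarrow> (nat \<Rightarrow> nat)" where
  "move_to_top k \<pi> = (\<lambda>i. if i = 1 then k
                          else if 1 < i \<and> i \<le> inv \<pi> k then \<pi> (i - 1)
                          else \<pi> i)"

definition random_to_top :: "nat \<Rightarrow> (nat \<Rightarrow> nat) \<Rightarrow> (nat \<Rightarrow> nat) pmf" where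
  "random_to_top n \<pi> = map_pmf (\<lambda>k. move_to_top k \<pi>) (pmf_of_set {1..n})"

text \<open>
  Each step of the monadic bind draws a fresh card, so the selections are independent.
  The value at \<open>n = 0\<close> is meaningless (\<open>pmf_of_set {}\<close> is unspecified).
\<close>

primrec iterated_random_to_top :: "nat \<Rightarrow> nat \<Rightarrow> (nat \<Rightarrow> nat) pmf" where
  "iterated_random_to_top n 0 = return_pmf id"
| "iterated_random_to_top n (Suc r) =
     bind_pmf (iterated_random_to_top n r) (random_to_top n)"

definition descents :: "nat \<Rightarrow> (nat \<Rightarrow> nat) \<Rightarrow> nat" where
  "descents n \<pi> = card {i \<in> {1..<n}. \<pi> i > \<pi> (i + 1)}"

text \<open>Law of \<open>(D - b) / sqrt n\<close>, where \<open>D\<close> is the number of descents after \<open>r\<close> shuffles.\<close>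

definition normalized_descents_law :: "nat \<Rightarrow> nat \<Rightarrow> real \<Rightarrow> real measure" where
  "normalized_descents_law r n b =
     distr (measure_pmf (iterated_random_to_top n r)) borel
       (\<lambda>\<pi>. (real (descents n \<pi>) - b) / sqrt (real n))"

text \<open>
  The second parameter is the variance, whereas \<^const>\<open>normal_density\<close> takes the standard
  deviation. Only meaningful for positive variance.
\<close>

definition normal_distribution :: "real \<Rightarrow> real \<Rightarrow> real measure" where
  "normal_distribution \<mu> v = density lborel (\<lambda>x. ennreal (normal_density \<mu> (sqrt v) x))"

text \<open>In one-line notation, \<^const>\<open>move_to_top\<close> removes the card and puts it in front.\<close>

lemma move_to_top_one_line:
  assumes \<pi>: "\<pi> permutes {1..n}" and k: "k \<in> {1..n}"
  shows "map (move_to_top k \<pi>) [1..<Suc n] = k # remove1 k (map \<pi> [1..<Suc n])"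
proof -
  define j where "j = inv \<pi> k"
  have j: "\<pi> j = k" "1 \<le> j" "j \<le> n"
    using permutes_inverses(1)[OF \<pi>] permutes_in_image[OF permutes_inv[OF \<pi>], of k] k
    by (auto simp: j_def)
  have inj: "inj \<pi>" using \<pi> by (rule permutes_inj)
  have "[1..<Suc n] = [1..<j] @ [j..<Suc n]"
    using upt_add_eq_append[of 1 j "Suc n - j"] j by (simp del: upt_Suc)
  also have "[j..<Suc n] = j # [Suc j..<Suc n]"
    using j by (intro upt_conv_Cons) simp
  finally have split: "[1..<Suc n] = [1..<j] @ j # [Suc j..<Suc n]" .
  have "k \<notin> set (map \<pi> [1..<j])"
  proof
    assume "k \<in> set (map \<pi> [1..<j])"
    then obtain x where "x < j" "\<pi> x = \<pi> j" using j(1) by auto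
    thus False using injD[OF inj] by blast
  qed
  hence rhs: "remove1 k (map \<pi> [1..<Suc n]) = map \<pi> [1..<j] @ map \<pi> [Suc j..<Suc n]"
    unfolding split map_append list.map by (simp add: remove1_append j(1) del: upt_Suc set_map)
  have "[1..<Suc n] = 1 # [Suc 1..<Suc n]"
    using j by (intro upt_conv_Cons) simp
  also have "[Suc 1..<Suc n] = [Suc 1..<Suc j] @ [Suc j..<Suc n]"
    using upt_add_eq_append[of "Suc 1" "Suc j" "n - j"] j by (simp del: upt_Suc)
  finally have "map (move_to_top k \<pi>) [1..<Suc n]
      = move_to_top k \<pi> 1 # map (move_to_top k \<pi>) [Suc 1..<Suc j]
        @ map (move_to_top k \<pi>) [Suc j..<Suc n]"
    by (simp only: list.map map_append)
  moreover have "map (move_to_top k \<pi>) [Suc 1..<Suc j] = map \<pi> [1..<j]"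
  proof (rule nth_equalityI)
    fix i assume i: "i < length (map (move_to_top k \<pi>) [Suc 1..<Suc j])"
    then have "map (move_to_top k \<pi>) [Suc 1..<Suc j] ! i = move_to_top k \<pi> (Suc (Suc i))"
      by (simp del: upt_Suc)
    also have "\<dots> = \<pi> (Suc i)"
      using i by (auto simp: move_to_top_def simp flip: j_def simp del: upt_Suc)
    finally show "map (move_to_top k \<pi>) [Suc 1..<Suc j] ! i = map \<pi> [1..<j] ! i"
      using i by (simp del: upt_Suc)
  qed (simp del: upt_Suc)
  moreover have "map (move_to_top k \<pi>) [Suc j..<Suc n] = map \<pi> [Suc j..<Suc n]"
    using j by (auto simp: move_to_top_def simp flip: j_def)
  moreover have "move_to_top k \<pi> 1 = k"
    by (simp add: move_to_top_def)
  ultimately show ?thesis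
    by (simp only: rhs list.map map_append)
qed

end

theory Submission
  imports Defs "HOL-Combinatorics.Multiset_Permutations" "HOL-Real_Asymp.Real_Asymp"
begin

text \<open>
  After \<open>r\<close> shuffles let \<open>M\<close> be the number of distinct cards selected so far. Given \<open>M = m\<close>, the
  top \<open>m\<close> cards form a uniformly random sequence of distinct cards and the others lie below them in
  increasing order, so up to an error of \<open>1\<close> the number of descents is that of a uniformly random
  permutation of \<open>m\<close> letters. Both this descent number (as a function of \<open>m\<close>) and \<open>M\<close> (as a
  function of \<open>r\<close>) are Markov chains \<open>X\<close> that increase by \<open>1\<close> with probability \<open>a k - b k * X k\<close>.
  For such a chain a suitable multiple of \<open>X k - \<mu> k\<close> is a martingale with small increments, whose
  characteristic function can be followed step by step and is Gaussian up to \<open>O(1 / sqrt n)\<close>.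
  The two Gaussian fluctuations add up to the variance in (i). In (ii) the expected number of
  cards never selected is at most \<open>sqrt n * exp (- \<gamma> n)\<close>, so \<open>M\<close> does not contribute.
\<close>

text \<open>Error budget: the martingale weights have size O(1 / sqrt n), so the third-order Taylor
  remainder of one step is O(n^(-3/2)) and O(n) steps may be summed. The second error comes from
  freezing the conditional variance at the mean of the chain. It is only quadratic in the weights,
  and is affordable because the state enters the success probability through a small slope (1 / (k +
  2) or 1 / n) while it deviates from its mean by O(sqrt k). Given M, the descent number has mean
  about M / 2 and variance about M / 12. Hence the limiting variance is the mean of M / 12 plus a
  quarter of the variance of M, both divided by n. The approximation given M is uniform in M \<le>
  n, so averaging over M costs nothing. The estimate for M itself has a bound that grows with r / n.
  Part (ii) gives no upper limit on r / n, which is why it compares M directly with n instead of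
  using a Gaussian approximation of M.\<close>

section \<open>Moment bounds and exponential estimates\<close>

lemma expectation_bind_pmf_finite:
  fixes h :: "'b \<Rightarrow> 'c::{banach, second_countable_topology}"
  assumes "finite (set_pmf p)" and "\<And>x. x \<in> set_pmf p \<Longrightarrow> finite (set_pmf (f x))"
  shows "measure_pmf.expectation (p \<bind> f) h
       = measure_pmf.expectation p (\<lambda>x. measure_pmf.expectation (f x) h)"
  by (subst pmf_expectation_bind[of "set_pmf p"]) (use assms in \<open>auto simp: integral_measure_pmf[of "set_pmf p"]\<close>)

lemma norm_expectation_diff_le:
  fixes f g :: "'a \<Rightarrow> complex"
  assumes fin: "finite (set_pmf p)" and le: "\<And>x. x \<in> set_pmf p \<Longrightarrow> cmod (f x - g x) \<le> h x"
  shows "cmod (measure_pmf.expectation p f - measure_pmf.expectation p g) \<le> measure_pmf.expectation p h"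
proof -
  have [simp]: "integrable (measure_pmf p) k" for k :: "'a \<Rightarrow> 'c::{banach, second_countable_topology}"
    using fin by (rule integrable_measure_pmf_finite)
  have "cmod (measure_pmf.expectation p (\<lambda>x. f x - g x)) \<le> measure_pmf.expectation p (\<lambda>x. cmod (f x - g x))"
    by (rule integral_norm_bound)
  also have "\<dots> \<le> measure_pmf.expectation p h"
    by (intro integral_mono_AE) (auto simp: AE_measure_pmf_iff le)
  finally show ?thesis by simp
qed

lemma expectation_abs_le_sqrt:
  fixes f :: "'a \<Rightarrow> real"
  assumes "finite (set_pmf p)"
  shows "measure_pmf.expectation p (\<lambda>x. \<bar>f x\<bar>) \<le> sqrt (measure_pmf.expectation p (\<lambda>x. (f x)\<^sup>2))"
proof -
  have [simp]: "integrable (measure_pmf p) k" for k :: "'a \<Rightarrow> real"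
    using assms by (rule integrable_measure_pmf_finite)
  \<comment> \<open>Jensen's inequality in the form that the variance of
    \<open>\<bar>f x\<bar>\<close> is nonnegative.\<close>
  have "0 \<le> measure_pmf.variance p (\<lambda>x. \<bar>f x\<bar>)"
    by (rule measure_pmf.variance_positive)
  also have "\<dots> = measure_pmf.expectation p (\<lambda>x. (f x)\<^sup>2) - (measure_pmf.expectation p (\<lambda>x. \<bar>f x\<bar>))\<^sup>2"
    by (subst measure_pmf.variance_eq) auto
  finally show ?thesis
    by (intro real_le_rsqrt) simp
qed

lemma iexp_quadratic_approx:
  "cmod (iexp x - (1 + \<i> * x - complex_of_real (x\<^sup>2 / 2))) \<le> \<bar>x\<bar> ^ 3 / 6"
  using iexp_approx1[of x 2]
  by (simp add: numeral_eq_Suc power_mult_distrib field_simps)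

lemma exp_minus_linear_approx:
  fixes u :: real
  assumes "0 \<le> u"
  shows "\<bar>1 - u - exp (- u)\<bar> \<le> u\<^sup>2"
proof -
  have "exp (- u) \<le> 1 / (1 + u)"
    using exp_ge_add_one_self[of u] assms by (simp add: exp_minus field_simps)
  also have "\<dots> \<le> 1 - u + u\<^sup>2"
  proof -
    have "(1 - u + u\<^sup>2) * (1 + u) = 1 + u ^ 3" by algebra
    thus ?thesis using assms by (simp add: field_simps)
  qed
  finally show ?thesis using exp_ge_add_one_self[of "- u"] by simp
qed

lemma iexp_diff_le: "cmod (iexp x - iexp y) \<le> \<bar>x - y\<bar>"
proof -
  have "iexp x - iexp y = iexp y * (iexp (x - y) - 1)"
    by (simp add: algebra_simps flip: exp_add)
  moreover have "cmod (iexp (x - y) - 1) \<le> \<bar>x - y\<bar>"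
    using iexp_approx1[of "x - y" 0] by simp
  ultimately show ?thesis by (simp add: norm_mult)
qed

text \<open>The left side is the characteristic function of a centred Bernoulli variable. Its linear
  Taylor terms cancel by centring, the quadratic ones add up to the variance p (1 - p), and the
  values 1 - p and -p are at most 1 in modulus.\<close>

lemma bernoulli_char_approx:
  fixes p t :: real
  assumes "0 \<le> p" "p \<le> 1"
  shows "cmod (p * iexp (t * (1 - p)) + (1 - p) * iexp (- t * p)
             - complex_of_real (1 - t\<^sup>2 * (p * (1 - p)) / 2)) \<le> \<bar>t\<bar> ^ 3"
proof -
  define R where "R x = iexp x - (1 + \<i> * complex_of_real x - complex_of_real (x\<^sup>2 / 2))" for x
  have R: "cmod (R (t * y)) \<le> \<bar>t\<bar> ^ 3" if "\<bar>y\<bar> \<le> 1" for y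
  proof -
    have "cmod (R (t * y)) \<le> \<bar>t * y\<bar> ^ 3 / 6"
      unfolding R_def by (rule iexp_quadratic_approx)
    also have "\<dots> = \<bar>t\<bar> ^ 3 * (\<bar>y\<bar> ^ 3 / 6)"
      by (simp add: abs_mult power_mult_distrib)
    also have "\<dots> \<le> \<bar>t\<bar> ^ 3 * 1"
    proof (rule mult_left_mono)
      show "\<bar>y\<bar> ^ 3 / 6 \<le> 1" using power_le_one[of "\<bar>y\<bar>" 3] that by simp
    qed simp
    finally show ?thesis by simp
  qed
  have "p * iexp (t * (1 - p)) + (1 - p) * iexp (- t * p) - complex_of_real (1 - t\<^sup>2 * (p * (1 - p)) / 2)
      = p * R (t * (1 - p)) + complex_of_real (1 - p) * R (t * (- p))"
    unfolding R_def by (simp add: field_simps power2_eq_square)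
  also have "cmod \<dots> \<le> p * cmod (R (t * (1 - p))) + (1 - p) * cmod (R (t * (- p)))"
    by (rule order_trans[OF norm_triangle_ineq]) (use assms in \<open>simp add: norm_mult del: of_real_diff\<close>)
  also have "\<dots> \<le> p * \<bar>t\<bar> ^ 3 + (1 - p) * \<bar>t\<bar> ^ 3"
    using assms by (intro add_mono mult_left_mono R) auto
  finally show ?thesis by (simp add: algebra_simps)
qed

subsection \<open>Chains with Bernoulli increments of linear success probability\<close>

primrec bernoulli_chain :: "(nat \<Rightarrow> real) \<Rightarrow> (nat \<Rightarrow> real) \<Rightarrow> nat \<Rightarrow> nat pmf" where
  "bernoulli_chain a b 0 = return_pmf 0"
| "bernoulli_chain a b (Suc k) = bind_pmf (bernoulli_chain a b k)
     (\<lambda>x. map_pmf (\<lambda>s. if s then Suc x else x) (bernoulli_pmf (a k - b k * real x)))"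

lemma finite_set_bernoulli_chain [simp]: "finite (set_pmf (bernoulli_chain a b k))"
  by (induction k) (auto intro: finite_imageI)

text \<open>Linearity of the success probability in the state is what makes the recursion for the
  mean closed.\<close>

primrec bernoulli_chain_mean :: "(nat \<Rightarrow> real) \<Rightarrow> (nat \<Rightarrow> real) \<Rightarrow> nat \<Rightarrow> real" where
  "bernoulli_chain_mean a b 0 = 0"
| "bernoulli_chain_mean a b (Suc k) = bernoulli_chain_mean a b k + (a k - b k * bernoulli_chain_mean a b k)"

text \<open>\<open>bernoulli_pmf\<close> truncates its argument to [0, 1]; \<open>prob\<close>
  ensures that on the support nothing is truncated, so the step probabilities are truly linear in
  the state.\<close>

locale linear_bernoulli_chain =
  fixes a b :: "nat \<Rightarrow> real"
  assumes slope: "0 \<le> b k" "b k \<le> 1"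
    and prob: "x \<in> set_pmf (bernoulli_chain a b k) \<Longrightarrow> 0 \<le> a k - b k * real x"
              "x \<in> set_pmf (bernoulli_chain a b k) \<Longrightarrow> a k - b k * real x \<le> 1"
begin

abbreviation E :: "nat \<Rightarrow> (nat \<Rightarrow> 'c::{banach, second_countable_topology}) \<Rightarrow> 'c" where
  "E k f \<equiv> measure_pmf.expectation (bernoulli_chain a b k) f"

abbreviation "\<mu> \<equiv> bernoulli_chain_mean a b"

text \<open>Defined on reals so that it can be evaluated at the mean \<open>\<mu> k\<close>, which
  need not be an integer.\<close>

definition "step_prob k x = a k - b k * x" for x :: real

lemma integrable [simp]:
  fixes f :: "nat \<Rightarrow> 'c::{banach, second_countable_topology}"
  shows "integrable (measure_pmf (bernoulli_chain a b k)) f"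
  by (rule integrable_measure_pmf_finite) simp

lemma expectation_cong:
  "(\<And>x. x \<in> set_pmf (bernoulli_chain a b k) \<Longrightarrow> f x = g x) \<Longrightarrow> E k f = E k g"
  by (intro integral_cong_AE) (auto simp: AE_measure_pmf_iff)

lemma expectation_mono:
  fixes f g :: "nat \<Rightarrow> real"
  shows "(\<And>x. x \<in> set_pmf (bernoulli_chain a b k) \<Longrightarrow> f x \<le> g x) \<Longrightarrow> E k f \<le> E k g"
  by (intro integral_mono_AE) (auto simp: AE_measure_pmf_iff)

lemma expectation_Suc:
  fixes h :: "nat \<Rightarrow> 'c::{banach, second_countable_topology}"
  shows "E (Suc k) h = E k (\<lambda>x. step_prob k x *\<^sub>R h (Suc x) + (1 - step_prob k x) *\<^sub>R h x)"
proof -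
  have "E (Suc k) h = E k (\<lambda>x. measure_pmf.expectation
      (map_pmf (\<lambda>s. if s then Suc x else x) (bernoulli_pmf (a k - b k * real x))) h)"
    by (simp add: expectation_bind_pmf_finite)
  also have "\<dots> = E k (\<lambda>x. step_prob k x *\<^sub>R h (Suc x) + (1 - step_prob k x) *\<^sub>R h x)"
  proof (rule expectation_cong)
    fix x assume "x \<in> set_pmf (bernoulli_chain a b k)"
    from prob[OF this] show "measure_pmf.expectation
        (map_pmf (\<lambda>s. if s then Suc x else x) (bernoulli_pmf (a k - b k * real x))) h
        = step_prob k x *\<^sub>R h (Suc x) + (1 - step_prob k x) *\<^sub>R h x"
      unfolding step_prob_def
      by (simp add: integral_measure_pmf[of UNIV] UNIV_bool add.commute)
  qed
  finally show ?thesis .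
qed

lemma expectation_id: "E k real = \<mu> k"
proof (induction k)
  case (Suc k)
  have "E (Suc k) real = E k (\<lambda>x. a k + (1 - b k) * real x)"
    unfolding expectation_Suc step_prob_def by (rule expectation_cong) (simp add: algebra_simps)
  also have "\<dots> = a k + (1 - b k) * E k real" by simp
  finally show ?case by (simp add: Suc algebra_simps)
qed simp

lemma step_prob_bounds:
  assumes "x \<in> set_pmf (bernoulli_chain a b k)"
  shows "0 \<le> step_prob k x" "step_prob k x \<le> 1"
  using prob[OF assms] by (auto simp: step_prob_def)

lemma mean_step_prob: "step_prob k (\<mu> k) = E k (\<lambda>x. step_prob k x)"
  by (simp add: step_prob_def expectation_id)

text \<open>By linearity the probability frozen at the mean is itself an average of genuine
  probabilities.\<close>

lemma mean_step_prob_bounds: "0 \<le> step_prob k (\<mu> k)" "step_prob k (\<mu> k) \<le> 1"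
proof -
  show "0 \<le> step_prob k (\<mu> k)"
    unfolding mean_step_prob using expectation_mono[of k "\<lambda>_. 0"] step_prob_bounds by simp
  show "step_prob k (\<mu> k) \<le> 1"
    unfolding mean_step_prob using expectation_mono[of k _ "\<lambda>_. 1"] step_prob_bounds by simp
qed

lemma mean_Suc: "real x - \<mu> (Suc k) = (1 - b k) * (real x - \<mu> k) - step_prob k x"
  by (simp add: step_prob_def algebra_simps)

lemma mult_one_minus_le: "p * (1 - p) \<le> 1 / 4" for p :: real
  using zero_le_power2[of "p - 1 / 2"] by (simp add: power2_eq_square algebra_simps)

text \<open>Each step contracts the old deviation by 1 - b k and adds a Bernoulli variance of at
  most 1 / 4. Only the order of magnitude matters here; the exact variance emerges from the
  characteristic function.\<close>

lemma variance_le: "E k (\<lambda>x. (real x - \<mu> k)\<^sup>2) \<le> real k / 4"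
proof (induction k)
  case (Suc k)
  have "E (Suc k) (\<lambda>x. (real x - \<mu> (Suc k))\<^sup>2)
      = E k (\<lambda>x. (1 - b k)\<^sup>2 * (real x - \<mu> k)\<^sup>2 + step_prob k x * (1 - step_prob k x))"
    unfolding expectation_Suc
  proof (rule expectation_cong)
    fix x :: nat
    have "real (Suc x) - \<mu> (Suc k) = (1 - b k) * (real x - \<mu> k) + (1 - step_prob k x)"
      using mean_Suc[of x k] by simp
    then have up: "(real (Suc x) - \<mu> (Suc k))\<^sup>2 = ((1 - b k) * (real x - \<mu> k) + (1 - step_prob k x))\<^sup>2"
      by (rule arg_cong)
    have down: "(real x - \<mu> (Suc k))\<^sup>2 = ((1 - b k) * (real x - \<mu> k) - step_prob k x)\<^sup>2"
      by (rule arg_cong[OF mean_Suc])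
    \<comment> \<open>The new increment is conditionally centred, so the cross term with the old
      deviation vanishes.\<close>
    have "p * (c * d + (1 - p))\<^sup>2 + (1 - p) * (c * d - p)\<^sup>2 = c\<^sup>2 * d\<^sup>2 + p * (1 - p)" for p c d :: real
      by algebra
    then show "step_prob k x *\<^sub>R (real (Suc x) - \<mu> (Suc k))\<^sup>2 + (1 - step_prob k x) *\<^sub>R (real x - \<mu> (Suc k))\<^sup>2
        = (1 - b k)\<^sup>2 * (real x - \<mu> k)\<^sup>2 + step_prob k x * (1 - step_prob k x)"
      unfolding up down real_scaleR_def .
  qed
  also have "\<dots> \<le> E k (\<lambda>x. (real x - \<mu> k)\<^sup>2 + 1 / 4)"
  proof (intro expectation_mono add_mono mult_one_minus_le)
    fix x
    have "(1 - b k)\<^sup>2 \<le> 1" using slope[of k] by (intro power_le_one) auto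
    then show "(1 - b k)\<^sup>2 * (real x - \<mu> k)\<^sup>2 \<le> (real x - \<mu> k)\<^sup>2"
      by (simp add: mult_left_le_one_le)
  qed
  also have "\<dots> \<le> real (Suc k) / 4" using Suc by simp
  finally show ?case .
qed simp

lemma mean_abs_deviation_le: "E k (\<lambda>x. \<bar>real x - \<mu> k\<bar>) \<le> sqrt (real k)"
proof -
  have "E k (\<lambda>x. \<bar>real x - \<mu> k\<bar>) \<le> sqrt (E k (\<lambda>x. (real x - \<mu> k)\<^sup>2))"
    by (rule expectation_abs_le_sqrt) simp
  also have "\<dots> \<le> sqrt (real k)"
    using variance_le[of k] by simp
  finally show ?thesis .
qed

text \<open>
  The weights \<open>t\<close> make \<open>t k * (X k - \<mu> k)\<close> a martingale in \<open>k\<close>. Up to small errors, one step then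
  multiplies its characteristic function by \<open>1 - v / 2\<close>, where \<open>v\<close> is the conditional variance
  of the increment evaluated at the mean of the chain.
\<close>

lemma characteristic_function_approx:
  assumes weights: "\<And>k. k < r \<Longrightarrow> t k = t (Suc k) * (1 - b k)"
    and T: "\<And>k. k \<le> r \<Longrightarrow> \<bar>t k\<bar> \<le> T"
  shows "cmod (E r (\<lambda>x. iexp (t r * (real x - \<mu> r)))
           - exp (- (\<Sum>k<r. (t (Suc k))\<^sup>2 * (step_prob k (\<mu> k) * (1 - step_prob k (\<mu> k)))) / 2))
         \<le> (\<Sum>k<r. T ^ 3 + T ^ 4 + T\<^sup>2 * b k * sqrt (real k))"
proof -
  define v where "v k = (t (Suc k))\<^sup>2 * (step_prob k (\<mu> k) * (1 - step_prob k (\<mu> k)))" for k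
  define F where "F k = E k (\<lambda>x. iexp (t k * (real x - \<mu> k)))" for k
  define G where "G k = exp (- (\<Sum>j<k. v j) / 2)" for k
  have "cmod (F k - G k) \<le> (\<Sum>j<k. T ^ 3 + T ^ 4 + T\<^sup>2 * b j * sqrt (real j))" if "k \<le> r" for k
    using that
  proof (induction k)
    case 0
    show ?case by (simp add: F_def G_def)
  next
    case (Suc k)
    define s where "s = t (Suc k)"
    have s: "\<bar>s\<bar> \<le> T" using T Suc.prems by (simp add: s_def)
    have T0: "0 \<le> T" using s by linarith
    define \<pi> where "\<pi> = step_prob k (\<mu> k)"
    have \<pi>: "0 \<le> \<pi>" "\<pi> \<le> 1" unfolding \<pi>_def by (rule mean_step_prob_bounds)+
    have v: "v k = s\<^sup>2 * (\<pi> * (1 - \<pi>))" by (simp add: v_def s_def \<pi>_def)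
    have s2: "s\<^sup>2 \<le> T\<^sup>2" using power_mono[OF s, of 2] by simp
    have v0: "0 \<le> v k" using \<pi> by (simp add: v)
    have v1: "v k \<le> T\<^sup>2"
    proof -
      have "v k \<le> T\<^sup>2 * 1"
        unfolding v using mult_one_minus_le[of \<pi>] \<pi> by (intro mult_mono s2) auto
      thus ?thesis by simp
    qed
    define \<phi> where "\<phi> p = p * iexp (s * (1 - p)) + (1 - p) * iexp (- s * p)" for p :: real
    have F_Suc: "F (Suc k) = E k (\<lambda>x. iexp (t k * (real x - \<mu> k)) * \<phi> (step_prob k x))"
      unfolding F_def expectation_Suc
    proof (rule expectation_cong)
      fix x
      have tk: "t k = s * (1 - b k)" using weights[of k] Suc.prems by (simp add: s_def)
      \<comment> \<open>The recursion of the weights absorbs the drift: what remains is the old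
        weighted deviation plus s times a centred Bernoulli variable, whose characteristic function
        is \<open>\<phi>\<close>.\<close>
      have 1: "t (Suc k) * (real x - \<mu> (Suc k)) = t k * (real x - \<mu> k) + - s * step_prob k x"
        unfolding mean_Suc tk s_def by (simp add: algebra_simps)
      then have 2: "t (Suc k) * (real (Suc x) - \<mu> (Suc k))
          = t k * (real x - \<mu> k) + s * (1 - step_prob k x)"
        by (simp add: s_def algebra_simps)
      have add: "iexp (y + z) = iexp y * iexp z" for y z
        by (simp add: algebra_simps flip: exp_add)
      show "step_prob k x *\<^sub>R iexp (t (Suc k) * (real (Suc x) - \<mu> (Suc k)))
          + (1 - step_prob k x) *\<^sub>R iexp (t (Suc k) * (real x - \<mu> (Suc k)))
          = iexp (t k * (real x - \<mu> k)) * \<phi> (step_prob k x)"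
        unfolding 1 2 add \<phi>_def scaleR_conv_of_real by (simp add: algebra_simps)
    qed
    have "cmod (F (Suc k) - (1 - v k / 2) * F k)
        = cmod (E k (\<lambda>x. iexp (t k * (real x - \<mu> k)) * \<phi> (step_prob k x))
            - E k (\<lambda>x. (1 - v k / 2) * iexp (t k * (real x - \<mu> k))))"
      unfolding F_Suc by (simp only: F_def integral_mult_right_zero)
    also have "\<dots> \<le> E k (\<lambda>x. T ^ 3 + T\<^sup>2 * b k * \<bar>real x - \<mu> k\<bar> / 2)"
    proof (rule norm_expectation_diff_le)
      fix x assume x: "x \<in> set_pmf (bernoulli_chain a b k)"
      define p where "p = step_prob k x"
      have p: "0 \<le> p" "p \<le> 1" using step_prob_bounds[OF x] by (auto simp: p_def)
      have "\<phi> p - complex_of_real (1 - v k / 2)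
          = (\<phi> p - complex_of_real (1 - s\<^sup>2 * (p * (1 - p)) / 2))
            + complex_of_real ((s\<^sup>2 / 2) * (\<pi> * (1 - \<pi>) - p * (1 - p)))"
        by (simp add: v field_simps)
      also have "cmod \<dots> \<le> \<bar>s\<bar> ^ 3 + \<bar>(s\<^sup>2 / 2) * (\<pi> * (1 - \<pi>) - p * (1 - p))\<bar>"
        unfolding \<phi>_def by (intro order_trans[OF norm_triangle_ineq] add_mono bernoulli_char_approx p)
           (simp only: norm_of_real real_norm_def order_refl)
      \<comment> \<open>Factoring the difference of the two Bernoulli variances shows that freezing
        the probability at the mean costs at most its deviation b k * |x - \<mu> k|, since the other
        factor lies in [-1, 1].\<close>
      also have "\<pi> * (1 - \<pi>) - p * (1 - p) = (\<pi> - p) * (1 - p - \<pi>)" by algebra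
      also have "\<bar>s\<^sup>2 / 2 * ((\<pi> - p) * (1 - p - \<pi>))\<bar> = s\<^sup>2 * (\<bar>\<pi> - p\<bar> * \<bar>1 - p - \<pi>\<bar>) / 2"
        by (simp add: abs_mult)
      also have "\<dots> \<le> T\<^sup>2 * (\<bar>\<pi> - p\<bar> * 1) / 2"
        using p \<pi> s2 by (intro divide_right_mono mult_mono) auto
      also have "\<bar>\<pi> - p\<bar> = b k * \<bar>real x - \<mu> k\<bar>"
      proof -
        have "\<pi> - p = b k * (real x - \<mu> k)" by (simp add: \<pi>_def p_def step_prob_def algebra_simps)
        thus ?thesis using slope[of k] by (simp add: abs_mult)
      qed
      also have "\<bar>s\<bar> ^ 3 \<le> T ^ 3" using s by (intro power_mono) auto
      finally have "cmod (\<phi> p - complex_of_real (1 - v k / 2)) \<le> T ^ 3 + T\<^sup>2 * b k * \<bar>real x - \<mu> k\<bar> / 2"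
        by simp
      moreover have "iexp (t k * (real x - \<mu> k)) * \<phi> (step_prob k x)
            - (1 - v k / 2) * iexp (t k * (real x - \<mu> k))
          = iexp (t k * (real x - \<mu> k)) * (\<phi> p - complex_of_real (1 - v k / 2))"
        by (simp add: p_def algebra_simps)
      ultimately show "cmod (iexp (t k * (real x - \<mu> k)) * \<phi> (step_prob k x)
            - (1 - v k / 2) * iexp (t k * (real x - \<mu> k))) \<le> T ^ 3 + T\<^sup>2 * b k * \<bar>real x - \<mu> k\<bar> / 2"
        by (simp only: norm_mult) simp
    qed simp
    also have "\<dots> = T ^ 3 + T\<^sup>2 * b k * E k (\<lambda>x. \<bar>real x - \<mu> k\<bar>) / 2"
      by simp
    also have "\<dots> \<le> T ^ 3 + T\<^sup>2 * b k * sqrt (real k) / 2"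
      using slope[of k] by (intro add_left_mono divide_right_mono mult_left_mono mean_abs_deviation_le) auto
    also have "\<dots> \<le> T ^ 3 + T\<^sup>2 * b k * sqrt (real k)"
      using slope[of k] by simp
    finally have 1: "cmod (F (Suc k) - (1 - v k / 2) * F k) \<le> T ^ 3 + T\<^sup>2 * b k * sqrt (real k)" .
    have "cmod (F k) \<le> E k (\<lambda>x. cmod (iexp (t k * (real x - \<mu> k))))"
      unfolding F_def by (rule integral_norm_bound)
    hence F1: "cmod (F k) \<le> 1" by simp
    have 2: "cmod ((complex_of_real (1 - v k / 2 - exp (- (v k / 2)))) * F k) \<le> T ^ 4"
    proof -
      have "\<bar>1 - v k / 2 - exp (- (v k / 2))\<bar> \<le> (v k / 2)\<^sup>2"
        using v0 by (intro exp_minus_linear_approx) simp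
      also have "\<dots> \<le> (T\<^sup>2)\<^sup>2"
        using v0 v1 by (intro power_mono) auto
      finally have "\<bar>1 - v k / 2 - exp (- (v k / 2))\<bar> * cmod (F k) \<le> T ^ 4 * 1"
        using F1 T0 by (intro mult_mono) auto
      thus ?thesis unfolding norm_mult norm_of_real by simp
    qed
    \<comment> \<open>The Gaussian factor of a step is at most 1, so earlier errors are not
      amplified and the one-step errors simply add up.\<close>
    have 3: "cmod (complex_of_real (exp (- (v k / 2))) * (F k - G k)) \<le> cmod (F k - G k)"
      using v0 by (simp add: norm_mult mult_left_le_one_le)
    have "G (Suc k) = exp (- (v k / 2)) * G k"
      by (simp add: G_def field_simps flip: exp_add)
    hence "F (Suc k) - G (Suc k) = (F (Suc k) - (1 - v k / 2) * F k)
        + (complex_of_real (1 - v k / 2 - exp (- (v k / 2)))) * F k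
        + complex_of_real (exp (- (v k / 2))) * (F k - G k)"
      by (simp add: algebra_simps)
    also have "cmod \<dots> \<le> (T ^ 3 + T\<^sup>2 * b k * sqrt (real k)) + T ^ 4 + cmod (F k - G k)"
      using 1 2 3 norm_triangle_le[OF add_mono[OF norm_triangle_le[OF add_mono[OF 1 2]] 3]] by simp
    finally show ?case using Suc by simp
  qed
  from this[of r] show ?thesis by (simp add: F_def G_def v_def)
qed

end

subsection \<open>The Eulerian and the occupancy chain\<close>

lemma bernoulli_chain_le: "x \<in> set_pmf (bernoulli_chain a b k) \<Longrightarrow> x \<le> k"
  by (induction k arbitrary: x) (force split: if_splits)+

text \<open>
  \<open>eulerian k\<close> will be the law of the number of descents of a uniformly random permutation of
  \<open>k + 1\<close> letters: inserting a new largest letter at a random place creates a descent unless it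
  lands in a descent or at the end. With this shift of the index the mean is exactly \<open>k / 2\<close>.
\<close>

abbreviation "eulerian \<equiv> bernoulli_chain (\<lambda>k. (real k + 1) / (real k + 2)) (\<lambda>k. 1 / (real k + 2))"

text \<open>\<open>occupancy n r\<close> is the law of the number of distinct cards among \<open>r\<close> selections.\<close>

abbreviation "occupancy n \<equiv> bernoulli_chain (\<lambda>k. 1) (\<lambda>k. 1 / real n)"

text \<open>Sharper than the bound by the number of steps: once all n cards have been drawn, the
  success probability is 0 and the chain stops.\<close>

lemma occupancy_le:
  assumes "n > 0" "x \<in> set_pmf (occupancy n k)"
  shows "x \<le> n"
  using assms(2)
proof (induction k arbitrary: x)
  case (Suc k)
  then obtain y s where y: "y \<in> set_pmf (occupancy n k)" and s: "s \<in> set_pmf (bernoulli_pmf (1 - 1 / real n * real y))"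
    and x: "x = (if s then Suc y else y)"
    by auto
  show ?case
  proof (cases "y = n")
    case True
    then have "pmf (bernoulli_pmf (1 - 1 / real n * real y)) True = 0"
      using \<open>n > 0\<close> by simp
    then have "\<not> s" using s by (cases s) (auto simp: set_pmf_iff)
    then show ?thesis using True x by simp
  next
    case False
    then show ?thesis using Suc.IH[OF y] x by auto
  qed
qed simp

global_interpretation eulerian: linear_bernoulli_chain
  "\<lambda>k. (real k + 1) / (real k + 2)" "\<lambda>k. 1 / (real k + 2)"
proof
  fix k x
  assume "x \<in> set_pmf (eulerian k)"
  then have x: "x \<le> k" by (rule bernoulli_chain_le)
  then show "0 \<le> (real k + 1) / (real k + 2) - 1 / (real k + 2) * real x"
    by (simp flip: diff_divide_distrib)
  show "(real k + 1) / (real k + 2) - 1 / (real k + 2) * real x \<le> 1"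
    by (simp flip: diff_divide_distrib)
qed auto

lemma linear_bernoulli_chain_occupancy:
  assumes "n > 0"
  shows "linear_bernoulli_chain (\<lambda>k. 1) (\<lambda>k. 1 / real n)"
proof
  fix k x
  assume "x \<in> set_pmf (occupancy n k)"
  then have "x \<le> n" by (rule occupancy_le[OF assms])
  then show "0 \<le> 1 - 1 / real n * real x" "1 - 1 / real n * real x \<le> 1"
    using assms by (auto simp: field_simps)
qed (use assms in auto)

section \<open>Means and Gaussian approximations of the two chains\<close>

lemma eulerian_mean: "bernoulli_chain_mean (\<lambda>k. (real k + 1) / (real k + 2)) (\<lambda>k. 1 / (real k + 2)) k = real k / 2"
proof (induction k)
  case (Suc k)
  have "(real k + 1) / (real k + 2) - 1 / (real k + 2) * (real k / 2) = 1 / 2"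
    by (simp add: field_simps add_nonneg_eq_0_iff)
  then show ?case by (simp only: bernoulli_chain_mean.simps Suc) (simp add: add_divide_distrib)
qed simp

text \<open>A given card is missed by all k selections with probability (1 - 1 / n) ^ k.\<close>

lemma occupancy_mean:
  assumes "n > 0"
  shows "bernoulli_chain_mean (\<lambda>k. 1) (\<lambda>k. 1 / real n) k = real n * (1 - (1 - 1 / real n) ^ k)"
proof (induction k)
  case (Suc k)
  have "real n * (1 - x) + (1 - 1 / real n * (real n * (1 - x))) = real n * (1 - (1 - 1 / real n) * x)" for x
    using assms by (simp add: algebra_simps)
  then show ?case by (simp only: bernoulli_chain_mean.simps Suc power_Suc)
qed simp

text \<open>At the mean, inserting a letter creates a descent with probability exactly 1 / 2, so
  every step contributes the maximal Bernoulli variance 1 / 4.\<close>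

lemma eulerian_step_prob: "eulerian.step_prob k (real k / 2) = 1 / 2"
  unfolding eulerian.step_prob_def by (simp add: field_simps add_nonneg_eq_0_iff)

text \<open>Bounds the total cost of freezing the variance of the Eulerian chain: each term is at
  most 2 (sqrt (k + 1) - sqrt k), and these telescope.\<close>

lemma sum_sqrt_le: "(\<Sum>j<k. 1 / (real j + 2) * sqrt (real j)) \<le> 2 * sqrt (real k)"
proof (induction k)
  case (Suc k)
  define x y where "x = sqrt (real k)" and "y = sqrt (real k + 1)"
  have xy: "0 \<le> x" "x \<le> y" "0 < y" by (auto simp: x_def y_def)
  have sq: "x * x = real k" "y * y = real k + 1" by (auto simp: x_def y_def)
  have "x * (x + y) \<le> 2 * (y * y)"
    using mult_mono[OF xy(2) xy(2)] mult_right_mono[OF xy(2), of y] xy unfolding distrib_left by linarith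
  hence "x * (x + y) \<le> 2 * (real k + 2)"
    unfolding sq by simp
  hence "x / (real k + 2) \<le> 2 / (x + y)"
    using xy by (simp add: field_simps)
  also have "2 / (x + y) = 2 * (y - x)"
  proof -
    have "(y - x) * (x + y) = 1" using sq by (simp add: algebra_simps)
    thus ?thesis using xy by (simp add: field_simps)
  qed
  finally show ?case using Suc by (simp add: x_def y_def add.commute)
qed simp

lemma exp_minus_diff_le:
  fixes x y :: real
  assumes "0 \<le> x" "0 \<le> y"
  shows "\<bar>exp (- x) - exp (- y)\<bar> \<le> \<bar>x - y\<bar>"
proof -
  have le: "exp (- u) - exp (- v) \<le> v - u" if "0 \<le> u" "u \<le> v" for u v :: real
  proof -
    have "exp (- u) - exp (- v) = exp (- u) * (1 - exp (- (v - u)))"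
      by (simp add: algebra_simps flip: exp_add)
    also have "\<dots> \<le> 1 * (v - u)"
    proof (rule mult_mono)
      show "1 - exp (- (v - u)) \<le> v - u" using exp_ge_add_one_self[of "- (v - u)"] by linarith
    qed (use that in auto)
    finally show ?thesis by simp
  qed
  show ?thesis
    using le[of x y] le[of y x] assms by (cases "x \<le> y") auto
qed

text \<open>The sum of the squares of 1, ..., k + 1 without its first term, whence the - 1.\<close>

lemma eulerian_variance_sum:
  "(\<Sum>j<k. (real j + 2)\<^sup>2) = (real k + 1) * (real k + 2) * (2 * real k + 3) / 6 - 1"
  by (induction k) (auto simp: field_simps power2_eq_square)

text \<open>The weights grow linearly, so with m = k + 1 letters the variances sum to about (1 / 4)
  (1^2 + ... + m^2) / m^2, which is m / 12 to leading order. The error bound is uniform in k < n, as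
  needed for a random prefix length.\<close>

lemma eulerian_char_approx:
  fixes s :: real
  assumes k: "k < n"
  shows "cmod (measure_pmf.expectation (eulerian k) (\<lambda>x. iexp (s / sqrt n * (real x - real k / 2)))
           - exp (- (s\<^sup>2 * (real k + 1) / (24 * real n)))) \<le> (\<bar>s\<bar> ^ 3 + s ^ 4 + 3 * s\<^sup>2) / sqrt n"
proof -
  define N where "N = sqrt (real n)"
  have N: "N \<ge> 1" "N * N = real n" using k by (auto simp: N_def)
  define T where "T = \<bar>s\<bar> / N"
  \<comment> \<open>Solves t j = t (j + 1) (j + 1) / (j + 2) with the final value s / N.\<close>
  define t where "t j = s / N * (real j + 1) / (real k + 1)" for j :: nat
  define m where "m = real k + 1"
  have m: "1 \<le> m" "m \<le> real n" using k by (auto simp: m_def)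
  define V where "V = (\<Sum>j<k. (t (Suc j))\<^sup>2 * (1 / 2 * (1 - 1 / 2)))"
  have "cmod (measure_pmf.expectation (eulerian k) (\<lambda>x. iexp (t k * (real x - real k / 2))) - exp (- V / 2))
      \<le> (\<Sum>j<k. T ^ 3 + T ^ 4 + T\<^sup>2 * (1 / (real j + 2)) * sqrt (real j))"
    unfolding V_def
  proof (rule eulerian.characteristic_function_approx[of k t T, unfolded eulerian_mean eulerian_step_prob])
    show "t j = t (Suc j) * (1 - 1 / (real j + 2))" for j
    proof -
      have e: "1 - 1 / (real j + 2) = (real j + 1) / (real j + 2)" "real (Suc j) + 1 = real j + 2"
        by (simp_all add: field_simps)
      have c: "s / N * x / z = s / N * y / z * (x / y)" if "y \<noteq> 0" for x y z :: real
        using that by simp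
      show ?thesis unfolding t_def e by (rule c) simp
    qed
    show "\<bar>t j\<bar> \<le> T" if "j \<le> k" for j
    proof -
      have "\<bar>t j\<bar> = T * ((real j + 1) / (real k + 1))"
        using N by (simp add: t_def T_def abs_mult)
      also have "\<dots> \<le> T * 1"
        using that N by (intro mult_left_mono) (auto simp: T_def)
      finally show ?thesis by simp
    qed
  qed
  also have "\<dots> = real k * T ^ 3 + real k * T ^ 4 + T\<^sup>2 * (\<Sum>j<k. 1 / (real j + 2) * sqrt (real j))"
    by (simp add: sum.distrib sum_distrib_left algebra_simps)
  \<comment> \<open>The fourth-order term is weakened by a factor N \<ge> 1, so that all three terms
    have the common order 1 / N.\<close>
  also have "\<dots> \<le> (N * N) * T ^ 3 + (N * N) * T ^ 4 * N + T\<^sup>2 * (2 * N)"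
  proof (intro add_mono mult_left_mono)
    have "real k * T ^ 4 * 1 \<le> N * N * T ^ 4 * N"
      using k N by (intro mult_mono) (auto simp: T_def)
    thus "real k * T ^ 4 \<le> N * N * T ^ 4 * N" by simp
    show "real k * T ^ 3 \<le> N * N * T ^ 3"
      using k N by (intro mult_right_mono) (auto simp: T_def)
    have "2 * sqrt (real k) \<le> 2 * N" using k by (simp add: N_def)
    with sum_sqrt_le[of k] show "(\<Sum>j<k. 1 / (real j + 2) * sqrt (real j)) \<le> 2 * N" by linarith
  qed auto
  also have "\<dots> = (\<bar>s\<bar> ^ 3 + s ^ 4 + 2 * s\<^sup>2) / N"
    using N(1) by (simp add: T_def field_simps eval_nat_numeral)
  finally have 1: "cmod (measure_pmf.expectation (eulerian k) (\<lambda>x. iexp (t k * (real x - real k / 2))) - exp (- V / 2))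
      \<le> (\<bar>s\<bar> ^ 3 + s ^ 4 + 2 * s\<^sup>2) / N" .
  have "V = (\<Sum>j<k. s\<^sup>2 / (4 * real n * m\<^sup>2) * (real j + 2)\<^sup>2)"
    unfolding V_def
    by (intro sum.cong refl) (use N in \<open>simp add: t_def m_def power_mult_distrib power_divide add.commute flip: N(2) power2_eq_square\<close>)
  also have "\<dots> = s\<^sup>2 / (4 * real n * m\<^sup>2) * (m * (m + 1) * (2 * m + 1) / 6 - 1)"
    unfolding sum_distrib_left[symmetric] eulerian_variance_sum by (simp add: m_def algebra_simps)
  finally have V_eq: "V = s\<^sup>2 / (4 * real n * m\<^sup>2) * (m * (m + 1) * (2 * m + 1) / 6 - 1)" .
  have nz: "m \<noteq> 0" "real n \<noteq> 0" using m by auto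
  have V: "V / 2 - s\<^sup>2 * m / (24 * real n) = s\<^sup>2 / real n * ((3 * m\<^sup>2 + m - 6) / (48 * m\<^sup>2))"
    unfolding V_eq using nz by (simp add: field_simps power2_eq_square)
  have "\<bar>exp (- (V / 2)) - exp (- (s\<^sup>2 * m / (24 * real n)))\<bar> \<le> \<bar>V / 2 - s\<^sup>2 * m / (24 * real n)\<bar>"
    using m by (intro exp_minus_diff_le) (auto simp: V_def intro!: sum_nonneg)
  also have "\<dots> = s\<^sup>2 / real n * \<bar>(3 * m\<^sup>2 + m - 6) / (48 * m\<^sup>2)\<bar>"
    unfolding V using m by (simp add: abs_mult)
  also have "\<dots> \<le> s\<^sup>2 / real n * 1"
  proof (intro mult_left_mono)
    have "m \<le> m\<^sup>2" "1 \<le> m\<^sup>2" using m(1) by (auto simp: self_le_power)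
    then show "\<bar>(3 * m\<^sup>2 + m - 6) / (48 * m\<^sup>2)\<bar> \<le> 1"
      using m(1) by (simp add: abs_le_iff field_simps)
  qed auto
  also have "\<dots> \<le> s\<^sup>2 / N"
    using N mult_left_mono[of 1 N N] by (auto intro!: divide_left_mono simp flip: N(2))
  finally have "\<bar>exp (- V / 2) - exp (- (s\<^sup>2 * m / (24 * real n)))\<bar> \<le> s\<^sup>2 / N" by simp
  then have 2: "cmod (complex_of_real (exp (- V / 2)) - complex_of_real (exp (- (s\<^sup>2 * m / (24 * real n))))) \<le> s\<^sup>2 / N"
    by (simp only: norm_of_real real_norm_def flip: of_real_diff)
  from norm_diff_triangle_le[OF 1 2]
  have "cmod (measure_pmf.expectation (eulerian k) (\<lambda>x. iexp (t k * (real x - real k / 2)))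
      - complex_of_real (exp (- (s\<^sup>2 * m / (24 * real n)))))
      \<le> (\<bar>s\<bar> ^ 3 + s ^ 4 + 2 * s\<^sup>2) / N + s\<^sup>2 / N"
    by simp
  moreover have "t k = s / N" by (simp add: t_def)
  ultimately show ?thesis
    by (simp add: N_def m_def add_divide_distrib)
qed

text \<open>Squared martingale weights times the Bernoulli variances at the mean. The part with q ^
  k is a geometric series, where 1 / (1 - q) = n; in the part with q ^ (2 * k) all r summands are
  equal.\<close>

lemma occupancy_variance_sum:
  fixes q :: real
  assumes "0 < n" and q: "q = 1 - 1 / real n" "q \<noteq> 0"
  shows "(\<Sum>k<r. (q ^ (r - Suc k))\<^sup>2 * (q ^ k * (1 - q ^ k)))
       = real n / q * (q ^ r - q ^ (2 * r)) - real r * q ^ (2 * r) / q\<^sup>2"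
proof (induction r)
  case (Suc r)
  have "(\<Sum>k<Suc r. (q ^ (Suc r - Suc k))\<^sup>2 * (q ^ k * (1 - q ^ k)))
      = (\<Sum>k<r. q\<^sup>2 * ((q ^ (r - Suc k))\<^sup>2 * (q ^ k * (1 - q ^ k)))) + q ^ r * (1 - q ^ r)"
  proof -
    have "q ^ (r - k) = q * q ^ (r - Suc k)" if "k < r" for k
      using that by (metis Suc_diff_Suc power_Suc)
    then show ?thesis by (auto simp: power_mult_distrib intro!: sum.cong)
  qed
  also have "\<dots> = q\<^sup>2 * (real n / q * (q ^ r - q ^ (2 * r)) - real r * q ^ (2 * r) / q\<^sup>2) + q ^ r * (1 - q ^ r)"
    by (simp add: Suc flip: sum_distrib_left)
  also have "\<dots> = real n / q * (q ^ Suc r - q ^ (2 * Suc r)) - real (Suc r) * q ^ (2 * Suc r) / q\<^sup>2"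
  proof -
    define x where "x = q ^ r"
    have x: "q ^ (2 * r) = x\<^sup>2" "q ^ Suc r = q * x" "q ^ (2 * Suc r) = q\<^sup>2 * x\<^sup>2"
      by (auto simp: x_def power2_eq_square power_mult mult_2 power_add)
    have n: "real n * q = real n - 1" using assms(1) unfolding q(1) by (simp add: field_simps)
    have "q\<^sup>2 * (real n / q * (x - x\<^sup>2) - real r * x\<^sup>2 / q\<^sup>2) + x * (1 - x)
        = (real n * q) * (x - x\<^sup>2) - real r * x\<^sup>2 + x * (1 - x)"
      using q(2) by (simp add: field_simps power2_eq_square)
    also have "\<dots> = real n * x - (real n * q) * x\<^sup>2 - (real r + 1) * x\<^sup>2"
      unfolding n by (simp add: algebra_simps power2_eq_square)
    also have "\<dots> = real n / q * (q * x - q\<^sup>2 * x\<^sup>2) - (real r + 1) * (q\<^sup>2 * x\<^sup>2) / q\<^sup>2"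
      using q(2) by (simp add: field_simps power2_eq_square)
    finally show ?thesis unfolding x x_def[symmetric] by (simp add: add.commute)
  qed
  finally show ?case .
qed simp

text \<open>At most K n steps are made, so for fixed K the accumulated errors are O(1 / sqrt n). The
  condition n \<ge> 2 makes q n positive, since the closed form of the variance divides by
  it.\<close>

lemma occupancy_char_approx:
  fixes s K :: real
  defines "q \<equiv> \<lambda>n. 1 - 1 / real n"
  assumes n: "n \<ge> 2" and r: "real r \<le> K * real n"
  shows "cmod (measure_pmf.expectation (occupancy n r) (\<lambda>x. iexp (s / sqrt n * (real x - real n * (1 - q n ^ r))))
           - exp (- (s\<^sup>2 * (((q n ^ r - q n ^ (2 * r)) / q n - real r / real n * q n ^ (2 * r) / (q n)\<^sup>2)) / 2)))
         \<le> (K * (\<bar>s\<bar> ^ 3 + s ^ 4) + K * sqrt K * s\<^sup>2) / sqrt n"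
proof -
  have n0: "n > 0" using n by simp
  interpret occ: linear_bernoulli_chain "\<lambda>k. 1" "\<lambda>k. 1 / real n"
    by (rule linear_bernoulli_chain_occupancy[OF n0])
  define N where "N = sqrt (real n)"
  have N: "N \<ge> 1" "N * N = real n" using n by (auto simp: N_def)
  define T where "T = \<bar>s\<bar> / N"
  have T: "0 \<le> T" using N by (simp add: T_def)
  have K: "0 \<le> K" using r n0 by (metis of_nat_0_le_iff of_nat_0_less_iff order_trans zero_le_mult_iff not_less linorder_not_le)
  define p where "p = 1 - 1 / real n"
  have p: "0 < p" "p \<le> 1" using n by (auto simp: p_def)
  define t where "t j = s / N * p ^ (r - j)" for j :: nat
  \<comment> \<open>At the mean, the probability of a new card is the fraction of cards expected to
    be still missing.\<close>
  have step: "occ.step_prob k (real n * (1 - p ^ k)) = p ^ k" for k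
    using n0 by (simp add: occ.step_prob_def)
  have mean: "occ.\<mu> k = real n * (1 - p ^ k)" for k
    unfolding p_def by (rule occupancy_mean[OF n0])
  define V where "V = (\<Sum>k<r. (t (Suc k))\<^sup>2 * (p ^ k * (1 - p ^ k)))"
  have "cmod (measure_pmf.expectation (occupancy n r) (\<lambda>x. iexp (t r * (real x - real n * (1 - p ^ r)))) - exp (- V / 2))
      \<le> (\<Sum>j<r. T ^ 3 + T ^ 4 + T\<^sup>2 * (1 / real n) * sqrt (real j))"
    unfolding V_def
  proof (rule occ.characteristic_function_approx[of r t T, unfolded mean step])
    show "t j = t (Suc j) * (1 - 1 / real n)" if "j < r" for j
    proof -
      have "r - j = Suc (r - Suc j)" using that by simp
      then show ?thesis by (simp add: t_def p_def)
    qed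
    show "\<bar>t j\<bar> \<le> T" for j
    proof -
      have "\<bar>t j\<bar> = T * p ^ (r - j)"
        using N p by (simp add: t_def T_def abs_mult)
      also have "\<dots> \<le> T * 1"
        using T p by (intro mult_left_mono power_le_one) auto
      finally show ?thesis by simp
    qed
  qed
  also have "\<dots> \<le> (\<Sum>j<r. T ^ 3 + T ^ 4 + T\<^sup>2 * (1 / real n) * sqrt (real r))"
    using T by (intro sum_mono add_left_mono mult_left_mono) auto
  also have "\<dots> = real r * (T ^ 3 + T ^ 4 + T\<^sup>2 * (1 / real n) * sqrt (real r))"
    by simp
  also have "\<dots> \<le> (K * (N * N)) * (T ^ 3 + T ^ 4 * N + T\<^sup>2 * (1 / (N * N)) * (sqrt K * N))"
    unfolding N(2)
  proof (intro mult_mono add_mono)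
    show "T ^ 4 \<le> T ^ 4 * N" using N(1) T by (simp add: mult_le_cancel_left1)
    have "sqrt (real r) \<le> sqrt (K * real n)" using r by simp
    then show "sqrt (real r) \<le> sqrt K * N" by (simp add: N_def real_sqrt_mult)
  qed (use T N K r in auto)
  also have "\<dots> = (K * (\<bar>s\<bar> ^ 3 + s ^ 4) + K * sqrt K * s\<^sup>2) / N"
    using N(1) by (simp add: T_def field_simps eval_nat_numeral)
  also have "V = s\<^sup>2 * ((p ^ r - p ^ (2 * r)) / p - real r / real n * p ^ (2 * r) / p\<^sup>2)"
  proof -
    have "V = (\<Sum>k<r. s\<^sup>2 / real n * ((p ^ (r - Suc k))\<^sup>2 * (p ^ k * (1 - p ^ k))))"
      unfolding V_def
      by (intro sum.cong refl) (simp add: t_def power_mult_distrib power_divide flip: N(2) power2_eq_square)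
    also have "\<dots> = s\<^sup>2 / real n * (real n / p * (p ^ r - p ^ (2 * r)) - real r * p ^ (2 * r) / p\<^sup>2)"
      unfolding sum_distrib_left[symmetric]
      using p by (subst occupancy_variance_sum[OF n0 p_def]) auto
    also have "\<dots> = s\<^sup>2 * ((p ^ r - p ^ (2 * r)) / p - real r / real n * p ^ (2 * r) / p\<^sup>2)"
    proof -
      have "s\<^sup>2 / real n * (real n / p * X - real r * Y / Z) = s\<^sup>2 * (X / p - real r / real n * Y / Z)" for X Y Z
        using n0 by (simp add: right_diff_distrib)
      then show ?thesis .
    qed
    finally show ?thesis .
  qed
  also have "t r = s / N" by (simp add: t_def)
  finally show ?thesis
    by (simp add: N_def q_def p_def)
qed

subsection \<open>Descents of a random permutation\<close>

text \<open>Works on arbitrary lists because prefixes of the deck and insertions of a letter leave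
  the permutations of a fixed interval.\<close>

fun list_descents :: "'a::linorder list \<Rightarrow> nat" where
  "list_descents (x # y # zs) = (if x > y then 1 else 0) + list_descents (y # zs)"
| "list_descents _ = 0"

lemma list_descents_append:
  "xs \<noteq> [] \<Longrightarrow> ys \<noteq> [] \<Longrightarrow>
   list_descents (xs @ ys) = list_descents xs + list_descents ys + (if last xs > hd ys then 1 else 0)"
proof (induction xs rule: list_descents.induct)
  case ("2_2" x)
  then show ?case by (cases ys) auto
qed auto

lemma list_descents_conv_card:
  "list_descents xs = card {i. Suc i < length xs \<and> xs ! i > xs ! Suc i}"
proof (induction xs rule: list_descents.induct)
  case (1 x y zs)
  have "{i. Suc i < length (x # y # zs) \<and> (x # y # zs) ! i > (x # y # zs) ! Suc i}
      = (if x > y then {0} else {}) \<union> Suc ` {i. Suc i < length (y # zs) \<and> (y # zs) ! i > (y # zs) ! Suc i}"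
    (is "?L = ?R")
  proof (intro set_eqI)
    fix i show "i \<in> ?L \<longleftrightarrow> i \<in> ?R" by (cases i) auto
  qed
  moreover have "finite {i. Suc i < length (y # zs) \<and> (y # zs) ! i > (y # zs) ! Suc i}"
    by (rule finite_subset[of _ "{..<length (y # zs)}"]) auto
  ultimately show ?case
    by (subst list_descents.simps, subst 1, simp only:, subst card_Un_disjoint) (auto simp: card_image)
qed auto

lemma sorted_list_descents: "sorted xs \<Longrightarrow> list_descents xs = 0"
  by (induction xs rule: list_descents.induct) auto

text \<open>Only the junction can contribute a descent; this is the error of 1 made when the
  unselected cards are ignored.\<close>

lemma list_descents_append_sorted:
  assumes "sorted ys"
  shows "list_descents (xs @ ys) = list_descents xs \<or> list_descents (xs @ ys) = Suc (list_descents xs)"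
  using assms by (cases "xs = []"; cases "ys = []") (auto simp: list_descents_append sorted_list_descents)

lemma descents_conv_list_descents: "descents n \<pi> = list_descents (map \<pi> [1..<Suc n])"
proof -
  have "{i. Suc i < length (map \<pi> [1..<Suc n]) \<and> map \<pi> [1..<Suc n] ! i > map \<pi> [1..<Suc n] ! Suc i}
      = {i. Suc i < n \<and> \<pi> (Suc i) > \<pi> (Suc (Suc i))}"
    by (auto simp del: upt_Suc)
  moreover have "{i \<in> {1..<n}. \<pi> i > \<pi> (i + 1)} = Suc ` {i. Suc i < n \<and> \<pi> (Suc i) > \<pi> (Suc (Suc i))}"
    (is "?L = ?R")
  proof (intro set_eqI)
    fix i show "i \<in> ?L \<longleftrightarrow> i \<in> ?R" by (cases i) auto
  qed
  ultimately show ?thesis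
    by (simp add: descents_def list_descents_conv_card card_image del: upt_Suc)
qed

section \<open>Descents of uniform permutations and of their prefixes\<close>

lemma map_pmf_of_set_bool:
  assumes "finite A" "A \<noteq> {}"
  shows "map_pmf P (pmf_of_set A) = bernoulli_pmf (real (card {x \<in> A. P x}) / real (card A))"
proof (rule pmf_eqI)
  fix s
  have "card A > 0" using assms by (simp add: card_gt_0_iff)
  have le: "card {x \<in> A. P x} \<le> card A" using assms by (intro card_mono) auto
  have "A \<inter> {x. P x} = {x \<in> A. P x}" by auto
  then have T: "pmf (map_pmf P (pmf_of_set A)) True = real (card {x \<in> A. P x}) / real (card A)"
    using assms by (simp add: pmf_map measure_pmf_of_set vimage_def)
  have "pmf p False = 1 - pmf p True" for p :: "bool pmf"
  proof -
    have "(\<Sum>x\<in>UNIV. pmf p x) = 1" by (rule sum_pmf_eq_1) auto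
    then show ?thesis by (simp add: UNIV_bool)
  qed
  then show "pmf (map_pmf P (pmf_of_set A)) s
      = pmf (bernoulli_pmf (real (card {x \<in> A. P x}) / real (card A))) s"
    using T le \<open>card A > 0\<close> by (cases s) auto
qed

lemma takeWhile_insert_eq:
  assumes "b \<notin> set xs" "j \<le> length xs"
  shows "length (takeWhile (\<lambda>x. x \<noteq> b) (take j xs @ b # drop j xs)) = j"
proof -
  have "\<forall>x\<in>set (take j xs). x \<noteq> b" using assms(1) by (auto dest: in_set_takeD)
  then show ?thesis using assms(2) by (subst takeWhile_append2) auto
qed

text \<open>The new maximum forms a descent with its right neighbour, if there is one, and never
  with its left neighbour. What it can destroy is a descent between the two letters that it
  separates.\<close>

lemma list_descents_insert_max:
  fixes xs :: "'a::linorder list"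
  assumes "xs \<noteq> []" and b: "\<And>x. x \<in> set xs \<Longrightarrow> x < b"
  shows "list_descents (take j xs @ b # drop j xs)
       = (if j \<ge> length xs \<or> 0 < j \<and> xs ! (j - 1) > xs ! j then list_descents xs else Suc (list_descents xs))"
proof -
  consider "j \<ge> length xs" | "j = 0" | "0 < j" "j < length xs" by linarith
  then show ?thesis
  proof cases
    case 1
    moreover have "\<not> last xs > b" using assms(1) b[of "last xs"] by auto
    ultimately show ?thesis using assms(1) by (simp add: list_descents_append)
  next
    case 2
    then show ?thesis using assms by (cases xs) auto
  next
    case 3
    have ne: "take j xs \<noteq> []" "drop j xs \<noteq> []" using 3 by auto
    have l: "last (take j xs) = xs ! (j - 1)" using ne 3 by (subst last_conv_nth) (auto simp del: take_eq_Nil take_eq_Nil2)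
    have h: "hd (drop j xs) = xs ! j" using 3 by (simp add: hd_drop_conv_nth)
    have "\<not> xs ! (j - 1) > b" "b > xs ! j" using 3 b[of "xs ! (j - 1)"] b[of "xs ! j"] by auto
    moreover have "list_descents (b # drop j xs) = list_descents (drop j xs) + (if b > xs ! j then 1 else 0)"
      using ne h by (cases "drop j xs") auto
    ultimately have "list_descents (take j xs @ b # drop j xs)
        = list_descents (take j xs) + list_descents (drop j xs) + 1"
      using ne l by (simp add: list_descents_append)
    moreover have "list_descents (take j xs @ drop j xs) = list_descents (take j xs) + list_descents (drop j xs)
        + (if xs ! (j - 1) > xs ! j then 1 else 0)"
      using ne l h by (subst list_descents_append) auto
    ultimately show ?thesis using 3 by simp
  qed
qed

text \<open>Of the k + 2 places, one for each descent and the end leave the count unchanged. This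
  number depends on \<open>xs\<close> only through its descents, which is why the descent number
  alone is a Markov chain.\<close>

lemma random_insertion_list_descents:
  fixes xs :: "'a::linorder list"
  assumes len: "length xs = Suc k" and b: "\<And>x. x \<in> set xs \<Longrightarrow> x < b"
  shows "map_pmf (\<lambda>j. list_descents (take j xs @ b # drop j xs)) (pmf_of_set {..Suc k})
       = map_pmf (\<lambda>s. if s then Suc (list_descents xs) else list_descents xs)
           (bernoulli_pmf ((real k + 1) / (real k + 2) - 1 / (real k + 2) * real (list_descents xs)))"
proof -
  define S where "S = {j. Suc j < length xs \<and> xs ! j > xs ! Suc j}"
  have S: "S \<subseteq> {..<k}" using len by (auto simp: S_def)
  have cS: "card S = list_descents xs" by (simp add: S_def list_descents_conv_card)
  define P where "P j = (\<not> (j \<ge> length xs \<or> 0 < j \<and> xs ! (j - 1) > xs ! j))" for j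
  \<comment> \<open>A descent at index j is split by insertion at place j + 1, and the end is place
    k + 1.\<close>
  have "{j \<in> {..Suc k}. P j} = {..Suc k} - insert (Suc k) (Suc ` S)"
    using len by (auto simp: P_def S_def image_iff not_less_eq_eq gr0_conv_Suc le_Suc_eq)
  moreover have "card (insert (Suc k) (Suc ` S)) = Suc (card S)"
  proof -
    have "finite S" using S finite_subset by blast
    moreover have "Suc k \<notin> Suc ` S" using S by auto
    ultimately show ?thesis by (simp add: card_image)
  qed
  moreover have "insert (Suc k) (Suc ` S) \<subseteq> {..Suc k}" using S by auto
  ultimately have "card {j \<in> {..Suc k}. P j} = Suc k - list_descents xs"
    by (simp add: card_Diff_subset finite_subset[OF _ finite_atMost] cS)
  moreover have "list_descents xs \<le> Suc k"
    using card_mono[OF finite_lessThan S] cS by simp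
  ultimately have card: "real (card {j \<in> {..Suc k}. P j}) / real (card {..Suc k})
      = (real k + 1) / (real k + 2) - 1 / (real k + 2) * real (list_descents xs)"
    by (simp add: of_nat_diff diff_divide_distrib add.commute)
  have "map_pmf (\<lambda>j. list_descents (take j xs @ b # drop j xs)) (pmf_of_set {..Suc k})
      = map_pmf (\<lambda>s. if s then Suc (list_descents xs) else list_descents xs) (map_pmf P (pmf_of_set {..Suc k}))"
    unfolding map_pmf_comp
    using len b by (intro map_pmf_cong refl, subst list_descents_insert_max) (auto simp: P_def)
  also have "map_pmf P (pmf_of_set {..Suc k})
      = bernoulli_pmf ((real k + 1) / (real k + 2) - 1 / (real k + 2) * real (list_descents xs))"
    by (subst map_pmf_of_set_bool) (simp_all only: card finite_atMost, auto)
  finally show ?thesis .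
qed

lemma permutations_of_set_insert:
  assumes "b \<notin> A" "finite A"
  shows "permutations_of_set (insert b A)
       = (\<Union>xs\<in>permutations_of_set A. (\<lambda>j. take j xs @ b # drop j xs) ` {..card A})"
proof (intro equalityI subsetI)
  fix zs assume "zs \<in> permutations_of_set (insert b A)"
  then have zs: "set zs = insert b A" "distinct zs" by (auto dest: permutations_of_setD)
  then obtain us vs where uv: "zs = us @ b # vs" by (metis insertI1 split_list)
  have "us @ vs \<in> permutations_of_set A" using zs uv assms by (intro permutations_of_setI) auto
  moreover have "length us \<le> card A"
    using length_finite_permutations_of_set[OF calculation] by simp
  moreover have "zs = take (length us) (us @ vs) @ b # drop (length us) (us @ vs)"
    by (simp add: uv)
  ultimately show "zs \<in> (\<Union>xs\<in>permutations_of_set A. (\<lambda>j. take j xs @ b # drop j xs) ` {..card A})"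
    by blast
next
  fix zs assume "zs \<in> (\<Union>xs\<in>permutations_of_set A. (\<lambda>j. take j xs @ b # drop j xs) ` {..card A})"
  then obtain xs j where zs: "zs = take j xs @ b # drop j xs" and xs: "set xs = A" "distinct xs"
    by (auto dest: permutations_of_setD)
  have "distinct (take j xs @ drop j xs)" "set (take j xs @ drop j xs) = A" using xs by simp_all
  then show "zs \<in> permutations_of_set (insert b A)"
    unfolding zs using assms by (intro permutations_of_setI) (auto simp only: set_append distinct_append set_simps distinct.simps)
qed

text \<open>Deleting b recovers \<open>xs\<close> and the position of b recovers j, so the
  permutations fall into disjoint classes of equal size card A + 1.\<close>

lemma pmf_of_set_permutations_insert:
  assumes "b \<notin> A" "finite A"
  shows "pmf_of_set (permutations_of_set (insert b A))
       = pmf_of_set (permutations_of_set A) \<bind>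
           (\<lambda>xs. map_pmf (\<lambda>j. take j xs @ b # drop j xs) (pmf_of_set {..card A}))"
proof -
  have inj: "inj_on (\<lambda>j. take j xs @ b # drop j xs) {..card A}" if "xs \<in> permutations_of_set A" for xs
  proof (rule inj_on_inverseI[of _ "\<lambda>zs. length (takeWhile (\<lambda>x. x \<noteq> b) zs)"])
    fix j assume "j \<in> {..card A}"
    then show "length (takeWhile (\<lambda>x. x \<noteq> b) (take j xs @ b # drop j xs)) = j"
      using that assms(1) length_finite_permutations_of_set[OF that]
      by (intro takeWhile_insert_eq) (auto dest: permutations_of_setD)
  qed
  have "pmf_of_set (permutations_of_set (insert b A))
      = pmf_of_set (permutations_of_set A) \<bind>
          (\<lambda>xs. pmf_of_set ((\<lambda>j. take j xs @ b # drop j xs) ` {..card A}))"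
    unfolding permutations_of_set_insert[OF assms]
  proof (rule pmf_of_set_UN)
    show "card ((\<lambda>j. take j xs @ b # drop j xs) ` {..card A}) = Suc (card A)"
      if "xs \<in> permutations_of_set A" for xs
      using card_image[OF inj[OF that]] by simp
    show "disjoint_family_on (\<lambda>xs. (\<lambda>j. take j xs @ b # drop j xs) ` {..card A}) (permutations_of_set A)"
    proof -
      have rem: "remove1 b (take j xs @ b # drop j xs) = xs" if "xs \<in> permutations_of_set A" for xs j
        using that assms(1) by (subst remove1_append) (auto dest: permutations_of_setD in_set_takeD)
      show ?thesis
        unfolding disjoint_family_on_def
      proof (intro ballI impI equals0I)
        fix xs ys zs
        assume "xs \<in> permutations_of_set A" "ys \<in> permutations_of_set A" "xs \<noteq> ys"
          "zs \<in> (\<lambda>j. take j xs @ b # drop j xs) ` {..card A} \<inter> (\<lambda>j. take j ys @ b # drop j ys) ` {..card A}"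
        then obtain i j where "zs = take i xs @ b # drop i xs" "zs = take j ys @ b # drop j ys"
          by blast
        then show False
          using rem[OF \<open>xs \<in> permutations_of_set A\<close>, of i] rem[OF \<open>ys \<in> permutations_of_set A\<close>, of j] \<open>xs \<noteq> ys\<close>
          by simp
      qed
    qed
  qed (use assms in auto)
  also have "\<dots> = pmf_of_set (permutations_of_set A) \<bind>
           (\<lambda>xs. map_pmf (\<lambda>j. take j xs @ b # drop j xs) (pmf_of_set {..card A}))"
    using assms by (intro bind_pmf_cong refl) (auto simp: map_pmf_of_set_inj inj)
  finally show ?thesis .
qed

text \<open>For empty \<open>A\<close> the truncated \<open>card A - 1 = 0\<close> is right: both sides return \<open>0\<close>.\<close>

lemma list_descents_random_permutation:
  fixes A :: "'a::linorder set"
  assumes "finite A"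
  shows "map_pmf list_descents (pmf_of_set (permutations_of_set A)) = eulerian (card A - 1)"
  using assms
proof (induction A rule: finite_linorder_max_induct)
  case empty
  show ?case by (simp add: pmf_of_set_singleton)
next
  case (insert b A)
  have b: "b \<notin> A" using insert.hyps by blast
  show ?case
  proof (cases "card A")
    case 0
    then have "A = {}" using insert.hyps by simp
    then show ?thesis by (simp add: pmf_of_set_singleton)
  next
    case (Suc k)
    have "map_pmf list_descents (pmf_of_set (permutations_of_set (insert b A)))
        = pmf_of_set (permutations_of_set A) \<bind>
            (\<lambda>xs. map_pmf (\<lambda>j. list_descents (take j xs @ b # drop j xs)) (pmf_of_set {..Suc k}))"
      by (simp add: pmf_of_set_permutations_insert[OF b] insert.hyps Suc map_bind_pmf map_pmf_comp)
    also have "\<dots> = pmf_of_set (permutations_of_set A) \<bind>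
            (\<lambda>xs. map_pmf (\<lambda>s. if s then Suc (list_descents xs) else list_descents xs)
           (bernoulli_pmf ((real k + 1) / (real k + 2) - 1 / (real k + 2) * real (list_descents xs))))"
    proof (intro bind_pmf_cong refl random_insertion_list_descents)
      fix xs assume "xs \<in> set_pmf (pmf_of_set (permutations_of_set A))"
      then have xs: "xs \<in> permutations_of_set A" using insert.hyps by simp
      show "length xs = Suc k" using length_finite_permutations_of_set[OF xs] Suc by simp
      show "x < b" if "x \<in> set xs" for x
        using that permutations_of_setD(1)[OF xs] insert.hyps by blast
    qed
    also have "\<dots> = eulerian k \<bind> (\<lambda>d. map_pmf (\<lambda>s. if s then Suc d else d)
           (bernoulli_pmf ((real k + 1) / (real k + 2) - 1 / (real k + 2) * real d)))"
    proof -
      have "eulerian k = map_pmf list_descents (pmf_of_set (permutations_of_set A))"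
        using insert.IH Suc by simp
      then show ?thesis by (simp only: bind_map_pmf)
    qed
    also have "\<dots> = eulerian (Suc k)" by simp
    finally show ?thesis using insert.hyps b Suc by simp
  qed
qed

text \<open>Conditioned on the set B of the first m entries and on everything after them, the prefix
  is a uniform permutation of B. Its descent law depends on B only through m, so the conditioning
  averages out.\<close>

lemma list_descents_take_random_permutation:
  fixes A :: "'a::linorder set"
  assumes A: "finite A" and m: "m \<le> card A"
  shows "map_pmf (\<lambda>xs. list_descents (take m xs)) (pmf_of_set (permutations_of_set A)) = eulerian (m - 1)"
proof -
  \<comment> \<open>The cells \<open>f (B, q)\<close> partition the permutations of A and each has
    \<open>fact m\<close> elements, so a uniform cell followed by a uniform member is
    uniform.\<close>
  define I where "I = (SIGMA B:{B. B \<subseteq> A \<and> card B = m}. permutations_of_set (A - B))"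
  define f :: "'a set \<times> 'a list \<Rightarrow> 'a list set"
    where "f = (\<lambda>(B, q). (\<lambda>p. p @ q) ` permutations_of_set B)"
  have fin: "finite I" unfolding I_def using A by auto
  obtain B where "B \<subseteq> A" "card B = m" using obtain_subset_with_card_n[OF m] by blast
  moreover have "permutations_of_set (A - B) \<noteq> {}" using A by simp
  ultimately have ne: "I \<noteq> {}" unfolding I_def by blast
  have B_fin: "finite B" if "B \<subseteq> A" for B using A that finite_subset by blast
  have union: "permutations_of_set A = \<Union>(f ` I)"
  proof (intro equalityI subsetI)
    fix xs assume xs: "xs \<in> permutations_of_set A"
    then have x: "set xs = A" "distinct xs" by (auto dest: permutations_of_setD)
    have len: "length xs = card A" using length_finite_permutations_of_set[OF xs] .
    have "set (take m xs) \<subseteq> A" using x by (auto dest: in_set_takeD)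
    moreover have "card (set (take m xs)) = m" using x m len by (simp add: distinct_card)
    moreover have "set (drop m xs) = A - set (take m xs)"
    proof -
      have "set (take m xs) \<union> set (drop m xs) = A" using x by (metis append_take_drop_id set_append)
      moreover have "set (take m xs) \<inter> set (drop m xs) = {}"
        using x(2) by (metis append_take_drop_id distinct_append)
      ultimately show ?thesis by blast
    qed
    ultimately have "(set (take m xs), drop m xs) \<in> I"
      using x unfolding I_def by (auto intro!: permutations_of_setI)
    moreover have "xs \<in> f (set (take m xs), drop m xs)"
      unfolding f_def using x by (auto intro!: image_eqI[of _ _ "take m xs"] permutations_of_setI)
    ultimately show "xs \<in> \<Union>(f ` I)" by blast
  next
    fix xs assume "xs \<in> \<Union>(f ` I)"
    then show "xs \<in> permutations_of_set A"
      by (auto simp: I_def f_def permutations_of_set_def)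
  qed
  have len: "length p = card B" if "p \<in> permutations_of_set B" for p and B :: "'a set"
    using that by (rule length_finite_permutations_of_set)
  have "pmf_of_set (permutations_of_set A) = pmf_of_set I \<bind> (\<lambda>i. pmf_of_set (f i))"
    unfolding union
  proof (rule pmf_of_set_UN)
    show "finite (\<Union>(f ` I))" using fin by (auto simp: f_def)
    show "I \<noteq> {}" by (rule ne)
    show "f i \<noteq> {}" if "i \<in> I" for i using that B_fin by (auto simp: f_def I_def)
    show "card (f i) = fact m" if "i \<in> I" for i
      using that B_fin by (auto simp: f_def I_def card_image inj_on_def)
    show "disjoint_family_on f I"
      unfolding disjoint_family_on_def
    proof (intro ballI impI equals0I)
      fix i j xs assume i: "i \<in> I" and j: "j \<in> I" and ij: "i \<noteq> j" and xs: "xs \<in> f i \<inter> f j"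
      have "i = (set (take m xs), drop m xs)" if "i \<in> I" "xs \<in> f i" for i
        using that by (auto simp: I_def f_def len dest: permutations_of_setD)
      with i j ij xs show False by blast
    qed
  qed
  then have "map_pmf (\<lambda>xs. list_descents (take m xs)) (pmf_of_set (permutations_of_set A))
      = pmf_of_set I \<bind> (\<lambda>i. map_pmf (\<lambda>xs. list_descents (take m xs)) (pmf_of_set (f i)))"
    by (simp add: map_bind_pmf)
  also have "\<dots> = pmf_of_set I \<bind> (\<lambda>i. eulerian (m - 1))"
  proof (intro bind_pmf_cong refl)
    fix i assume "i \<in> set_pmf (pmf_of_set I)"
    then obtain B q where i: "i = (B, q)" and B: "B \<subseteq> A" "card B = m"
      using fin ne by (auto simp: I_def)
    have "pmf_of_set (f i) = map_pmf (\<lambda>p. p @ q) (pmf_of_set (permutations_of_set B))"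
      unfolding i f_def using B_fin[OF B(1)] by (subst map_pmf_of_set_inj) (auto simp: inj_on_def)
    then have "map_pmf (\<lambda>xs. list_descents (take m xs)) (pmf_of_set (f i))
        = map_pmf list_descents (pmf_of_set (permutations_of_set B))"
      unfolding map_pmf_comp using B_fin[OF B(1)] B len
      by (auto simp: map_pmf_comp intro!: map_pmf_cong)
    then show "map_pmf (\<lambda>xs. list_descents (take m xs)) (pmf_of_set (f i)) = eulerian (m - 1)"
      using list_descents_random_permutation[OF B_fin[OF B(1)]] B by simp
  qed
  finally show ?thesis by simp
qed

subsection \<open>The deck after iterated shuffles\<close>

lemma move_to_top_permutes:
  assumes \<pi>: "\<pi> permutes {1..n}" and k: "k \<in> {1..n}"
  shows "move_to_top k \<pi> permutes {1..n}"
proof (rule bij_imp_permutes)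
  define l where "l = map \<pi> [1..<Suc n]"
  have set_upt: "set [1..<Suc n] = {1..n}" by auto
  have l: "set l = {1..n}" "distinct l"
    unfolding l_def set_map set_upt distinct_map
    using permutes_image[OF \<pi>] permutes_inj_on[OF \<pi>] by (simp, blast intro: distinct_upt)
  have one_line: "map (move_to_top k \<pi>) [1..<Suc n] = k # remove1 k l"
    unfolding l_def by (rule move_to_top_one_line[OF assms])
  have "distinct (map (move_to_top k \<pi>) [1..<Suc n])" "set (map (move_to_top k \<pi>) [1..<Suc n]) = {1..n}"
    unfolding one_line using set_remove1_eq[OF l(2), of k] distinct_remove1[OF l(2), of k] l(1) k by auto
  then show "bij_betw (move_to_top k \<pi>) {1..n} {1..n}"
    unfolding distinct_map set_map set_upt bij_betw_def by blast
next
  fix i assume i: "i \<notin> {1..n}"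
  have "inv \<pi> k \<in> {1..n}" using permutes_in_image[OF permutes_inv[OF \<pi>], of k] k by simp
  then have "i \<noteq> 1" "\<not> (1 < i \<and> i \<le> inv \<pi> k)" using i k by auto
  then show "move_to_top k \<pi> i = i"
    using permutes_not_in[OF \<pi> i] by (simp only: move_to_top_def if_False)
qed

lemma iterated_random_to_top_permutes:
  assumes "n > 0" "\<pi> \<in> set_pmf (iterated_random_to_top n r)"
  shows "\<pi> permutes {1..n}"
  using assms(2)
proof (induction r arbitrary: \<pi>)
  case (Suc r)
  then obtain \<rho> k where "\<rho> \<in> set_pmf (iterated_random_to_top n r)" "k \<in> {1..n}" "\<pi> = move_to_top k \<rho>"
    using assms(1) by (auto simp: random_to_top_def)
  then show ?case using Suc.IH move_to_top_permutes by blast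
qed (simp add: permutes_id)

text \<open>Turns a uniform permutation into the deck with m distinct cards selected: the selected
  cards stay on top in random order, the others are put back in increasing order.\<close>

definition sort_from :: "nat \<Rightarrow> 'a::linorder list \<Rightarrow> 'a list" where
  "sort_from m xs = take m xs @ sort (drop m xs)"

lemma sort_remove1: "sort (remove1 x xs) = remove1 x (sort xs)"
  by (rule properties_for_sort) (auto intro: sorted_remove1)

text \<open>The position j refers to the arrangement before its tail is sorted, so the card comes
  from the sorted part exactly if j \<ge> m. Removing it keeps the tail sorted and lengthens the
  prefix by one; for j < m only the prefix is rearranged.\<close>

lemma to_top_sort_from:
  assumes "distinct xs" "m \<le> length xs" "j < length xs"
  shows "xs ! j # remove1 (xs ! j) (sort_from m xs)
       = sort_from (if j < m then m else Suc m) (xs ! j # remove1 (xs ! j) xs)"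
proof -
  define x where "x = xs ! j"
  define us vs where "us = take m xs" and "vs = drop m xs"
  have xs: "xs = us @ vs" by (simp add: us_def vs_def)
  have len: "length us = m" using assms by (simp add: us_def)
  show ?thesis
  proof (cases "j < m")
    case True
    then have x: "x \<in> set us" using len by (auto simp: x_def xs nth_append)
    then have "length (remove1 x us) = m - 1" "m > 0" using len by (auto simp: length_remove1)
    then show ?thesis
      unfolding x_def[symmetric] using x True len
      by (auto simp: xs sort_from_def remove1_append take_Cons' drop_Cons')
  next
    case False
    then have "x \<in> set vs" using len assms(3) by (auto simp: x_def xs nth_append)
    then have x: "x \<notin> set us" using assms(1) by (auto simp: xs)
    then show ?thesis
      unfolding x_def[symmetric] using False len
      by (auto simp: xs sort_from_def remove1_append sort_remove1)
  qed
qed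

text \<open>A fixed position is moved, not a fixed card, so the map is invertible: reinsert the head
  at place j.\<close>

lemma map_pmf_to_top_permutations:
  assumes "finite A" "j < card A"
  shows "map_pmf (\<lambda>xs. xs ! j # remove1 (xs ! j) xs) (pmf_of_set (permutations_of_set A))
       = pmf_of_set (permutations_of_set A)"
proof (rule map_pmf_of_set_bij_betw)
  let ?f = "\<lambda>xs. xs ! j # remove1 (xs ! j) xs"
  have "inj_on ?f (permutations_of_set A)"
  proof (rule inj_on_inverseI[of _ "\<lambda>zs. take j (tl zs) @ hd zs # drop j (tl zs)"])
    fix xs assume xs: "xs \<in> permutations_of_set A"
    have j: "j < length xs" using assms length_finite_permutations_of_set[OF xs] by simp
    have decomp: "xs = take j xs @ xs ! j # drop (Suc j) xs" by (rule id_take_nth_drop[OF j])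
    have "distinct (take j xs @ xs ! j # drop (Suc j) xs)"
      using permutations_of_setD(2)[OF xs] decomp by simp
    then have "xs ! j \<notin> set (take j xs)" by auto
    then have "remove1 (xs ! j) (take j xs @ xs ! j # drop (Suc j) xs) = take j xs @ drop (Suc j) xs"
      by (simp add: remove1_append)
    then have "remove1 (xs ! j) xs = take j xs @ drop (Suc j) xs" using decomp by simp
    then show "take j (tl (?f xs)) @ hd (?f xs) # drop j (tl (?f xs)) = xs"
      using j decomp by simp
  qed
  moreover have "?f ` permutations_of_set A \<subseteq> permutations_of_set A"
  proof safe
    fix xs assume xs: "xs \<in> permutations_of_set A"
    then have "xs ! j \<in> A"
      using assms length_finite_permutations_of_set[OF xs] permutations_of_setD(1)[OF xs] by (auto intro: nth_mem)
    then show "?f xs \<in> permutations_of_set A"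
      using permutations_of_setD[OF xs] by (intro permutations_of_setI) auto
  qed
  ultimately show "bij_betw ?f (permutations_of_set A) (permutations_of_set A)"
    unfolding bij_betw_def by (simp add: endo_inj_surj)
qed (use assms in auto)

text \<open>A uniform card sits at a uniform position j of the unsorted arrangement. For fixed j the
  move preserves uniformity, so j matters only through whether it lies in the prefix. Thus the
  number of distinct cards evolves without reference to their order.\<close>

lemma random_to_top_sort_from:
  fixes A :: "'a::linorder set"
  assumes A: "finite A" "A \<noteq> {}" and m: "m \<le> card A"
  shows "pmf_of_set (permutations_of_set A) \<bind> (\<lambda>xs. map_pmf (\<lambda>x. x # remove1 x (sort_from m xs)) (pmf_of_set A))
       = map_pmf (\<lambda>s. if s then Suc m else m) (bernoulli_pmf (1 - 1 / real (card A) * real m)) \<bind>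
           (\<lambda>m'. map_pmf (sort_from m') (pmf_of_set (permutations_of_set A)))"
proof -
  define U where "U = pmf_of_set (permutations_of_set A)"
  define J where "J = pmf_of_set {..<card A}"
  have c: "card A > 0" using A by (simp add: card_gt_0_iff)
  have set_U: "set_pmf U = permutations_of_set A" using A by (simp add: U_def)
  have set_J: "set_pmf J = {..<card A}" unfolding J_def using c by (subst set_pmf_of_set) auto
  have "U \<bind> (\<lambda>xs. map_pmf (\<lambda>x. x # remove1 x (sort_from m xs)) (pmf_of_set A))
      = U \<bind> (\<lambda>xs. J \<bind> (\<lambda>j. return_pmf (sort_from (if j < m then m else Suc m) (xs ! j # remove1 (xs ! j) xs))))"
  proof (intro bind_pmf_cong refl)
    fix xs assume "xs \<in> set_pmf U"
    then have xs: "xs \<in> permutations_of_set A" by (simp add: set_U)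
    have len: "length xs = card A" by (rule length_finite_permutations_of_set[OF xs])
    have "pmf_of_set A = map_pmf ((!) xs) J"
      unfolding J_def
    proof (rule map_pmf_of_set_bij_betw[symmetric])
      show "bij_betw ((!) xs) {..<card A} A"
        using permutations_of_setD[OF xs] len by (intro bij_betw_nth) auto
    qed (use c in auto)
    then have "map_pmf (\<lambda>x. x # remove1 x (sort_from m xs)) (pmf_of_set A)
        = map_pmf (\<lambda>j. xs ! j # remove1 (xs ! j) (sort_from m xs)) J"
      by (simp add: map_pmf_comp)
    also have "\<dots> = map_pmf (\<lambda>j. sort_from (if j < m then m else Suc m) (xs ! j # remove1 (xs ! j) xs)) J"
      using permutations_of_setD(2)[OF xs] m len
      by (intro map_pmf_cong refl to_top_sort_from) (auto simp: set_J)
    finally show "map_pmf (\<lambda>x. x # remove1 x (sort_from m xs)) (pmf_of_set A)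
        = J \<bind> (\<lambda>j. return_pmf (sort_from (if j < m then m else Suc m) (xs ! j # remove1 (xs ! j) xs)))"
      by (simp add: map_pmf_def)
  qed
  \<comment> \<open>Exchanging the two independent draws allows j to be held fixed while the
    permutation is random.\<close>
  also have "\<dots> = J \<bind> (\<lambda>j. map_pmf (\<lambda>xs. sort_from (if j < m then m else Suc m) (xs ! j # remove1 (xs ! j) xs)) U)"
    by (subst bind_commute_pmf) (simp add: map_pmf_def)
  also have "\<dots> = J \<bind> (\<lambda>j. map_pmf (sort_from (if j < m then m else Suc m)) U)"
  proof (intro bind_pmf_cong refl)
    fix j assume "j \<in> set_pmf J"
    then have "map_pmf (\<lambda>xs. xs ! j # remove1 (xs ! j) xs) U = U"
      unfolding U_def using A by (intro map_pmf_to_top_permutations) (auto simp: set_J)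
    from arg_cong[OF this, of "map_pmf (sort_from (if j < m then m else Suc m))"]
    show "map_pmf (\<lambda>xs. sort_from (if j < m then m else Suc m) (xs ! j # remove1 (xs ! j) xs)) U
        = map_pmf (sort_from (if j < m then m else Suc m)) U"
      by (simp only: map_pmf_comp)
  qed
  also have "\<dots> = map_pmf (\<lambda>j. m \<le> j) J \<bind> (\<lambda>s. map_pmf (sort_from (if s then Suc m else m)) U)"
    by (auto simp: bind_map_pmf not_less intro!: bind_pmf_cong)
  also have "map_pmf (\<lambda>j. m \<le> j) J = bernoulli_pmf (1 - 1 / real (card A) * real m)"
  proof -
    have "{j \<in> {..<card A}. m \<le> j} = {m..<card A}" by auto
    then show ?thesis
      unfolding J_def using c m
      by (subst map_pmf_of_set_bool) (auto simp: of_nat_diff diff_divide_distrib)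
  qed
  finally show ?thesis by (simp add: U_def bind_map_pmf)
qed

text \<open>The form "random m, then \<open>sort_from m\<close> of an independent uniform
  permutation" is preserved by one shuffle, so the induction works with the law of the deck alone
  and never records which cards were selected.\<close>

lemma deck_after_shuffles:
  assumes n: "n > 0"
  shows "map_pmf (\<lambda>\<pi>. map \<pi> [1..<Suc n]) (iterated_random_to_top n r)
       = occupancy n r \<bind> (\<lambda>m. map_pmf (sort_from m) (pmf_of_set (permutations_of_set {1..n})))"
proof (induction r)
  case 0
  have "map_pmf (sort_from 0) (pmf_of_set (permutations_of_set {1..n}))
      = map_pmf (\<lambda>_. [1..<Suc n]) (pmf_of_set (permutations_of_set {1..n}))"
  proof (intro map_pmf_cong refl)
    fix xs assume "xs \<in> set_pmf (pmf_of_set (permutations_of_set {1..n}))"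
    then have "xs \<in> permutations_of_set {1..n}" by simp
    note xs = permutations_of_setD[OF this]
    have "sort xs = [1..<Suc n]"
    proof (rule sorted_distinct_set_unique)
      show "set (sort xs) = set [1..<Suc n]" unfolding set_sort xs(1) by auto
    qed (use xs(2) in \<open>simp_all del: upt_Suc\<close>)
    then show "sort_from 0 xs = [1..<Suc n]" by (simp add: sort_from_def)
  qed
  then show ?case by (simp add: bind_return_pmf del: upt_Suc)
next
  case (Suc r)
  let ?U = "pmf_of_set (permutations_of_set {1..n})"
  let ?L = "\<lambda>\<pi>. map \<pi> [1..<Suc n]"
  have "map_pmf ?L (iterated_random_to_top n (Suc r))
      = iterated_random_to_top n r \<bind> (\<lambda>\<pi>. map_pmf (\<lambda>k. k # remove1 k (?L \<pi>)) (pmf_of_set {1..n}))"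
    unfolding iterated_random_to_top.simps map_bind_pmf random_to_top_def map_pmf_comp
  proof (intro bind_pmf_cong map_pmf_cong refl)
    fix \<pi> k assume "\<pi> \<in> set_pmf (iterated_random_to_top n r)" "k \<in> set_pmf (pmf_of_set {1..n})"
    moreover have "set_pmf (pmf_of_set {1..n}) = {1..n}" using n by (intro set_pmf_of_set) auto
    ultimately show "?L (move_to_top k \<pi>) = k # remove1 k (?L \<pi>)"
      by (intro move_to_top_one_line iterated_random_to_top_permutes[OF n]) simp_all
  qed
  also have "\<dots> = map_pmf ?L (iterated_random_to_top n r) \<bind> (\<lambda>l. map_pmf (\<lambda>k. k # remove1 k l) (pmf_of_set {1..n}))"
    by (simp only: bind_map_pmf)
  also have "\<dots> = occupancy n r \<bind> (\<lambda>m. ?U \<bind> (\<lambda>l. map_pmf (\<lambda>k. k # remove1 k (sort_from m l)) (pmf_of_set {1..n})))"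
    unfolding Suc.IH by (simp add: bind_assoc_pmf bind_map_pmf)
  also have "\<dots> = occupancy n r \<bind> (\<lambda>m. map_pmf (\<lambda>s. if s then Suc m else m) (bernoulli_pmf (1 - 1 / real n * real m)) \<bind>
           (\<lambda>m'. map_pmf (sort_from m') ?U))"
  proof (intro bind_pmf_cong[of "occupancy n r"] refl)
    fix m assume "m \<in> set_pmf (occupancy n r)"
    then have "m \<le> card {1..n}" using occupancy_le[OF n] by simp
    from random_to_top_sort_from[OF _ _ this] n
    show "?U \<bind> (\<lambda>l. map_pmf (\<lambda>k. k # remove1 k (sort_from m l)) (pmf_of_set {1..n}))
        = map_pmf (\<lambda>s. if s then Suc m else m) (bernoulli_pmf (1 - 1 / real n * real m)) \<bind>
           (\<lambda>m'. map_pmf (sort_from m') ?U)"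
      by simp
  qed
  also have "\<dots> = occupancy n (Suc r) \<bind> (\<lambda>m. map_pmf (sort_from m) ?U)"
    by (simp add: bind_assoc_pmf)
  finally show ?case .
qed

subsection \<open>Characteristic functions and limits\<close>

lemma real_distribution_normalized_descents_law: "real_distribution (normalized_descents_law r n b)"
  unfolding normalized_descents_law_def by (rule prob_space.real_distribution_distr[OF prob_space_measure_pmf]) simp

lemma char_normalized_descents_law:
  assumes n: "n > 0"
  shows "char (normalized_descents_law r n b) s
       = measure_pmf.expectation (occupancy n r) (\<lambda>m. measure_pmf.expectation (pmf_of_set (permutations_of_set {1..n}))
           (\<lambda>xs. iexp (s * ((real (list_descents (sort_from m xs)) - b) / sqrt n))))"
proof -
  let ?h = "\<lambda>xs. iexp (s * ((real (list_descents xs) - b) / sqrt n))"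
  have "char (normalized_descents_law r n b) s
      = measure_pmf.expectation (iterated_random_to_top n r) (\<lambda>\<pi>. iexp (s * ((real (descents n \<pi>) - b) / sqrt n)))"
    unfolding char_def normalized_descents_law_def by (subst integral_distr) auto
  also have "\<dots> = measure_pmf.expectation (map_pmf (\<lambda>\<pi>. map \<pi> [1..<Suc n]) (iterated_random_to_top n r)) ?h"
    by (simp add: descents_conv_list_descents del: upt_Suc)
  also have "\<dots> = measure_pmf.expectation (occupancy n r) (\<lambda>m. measure_pmf.expectation
      (map_pmf (sort_from m) (pmf_of_set (permutations_of_set {1..n}))) ?h)"
    unfolding deck_after_shuffles[OF n]
    by (rule expectation_bind_pmf_finite) auto
  finally show ?thesis by simp
qed

lemma norm_iexp_mult_diff_le:
  fixes x y u v :: real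
  assumes "0 \<le> u" "0 \<le> v"
  shows "cmod (iexp x * exp (- u) - iexp y * exp (- v)) \<le> \<bar>x - y\<bar> + \<bar>u - v\<bar>"
proof -
  have "iexp x * exp (- u) - iexp y * exp (- v)
      = (iexp x - iexp y) * complex_of_real (exp (- u)) + iexp y * complex_of_real (exp (- u) - exp (- v))"
    by (simp add: algebra_simps)
  also have "cmod \<dots> \<le> cmod (iexp x - iexp y) * exp (- u) + \<bar>exp (- u) - exp (- v)\<bar>"
    by (rule order_trans[OF norm_triangle_ineq]) (simp add: norm_mult del: of_real_diff)
  also have "\<dots> \<le> \<bar>x - y\<bar> * 1 + \<bar>u - v\<bar>"
    using assms by (intro add_mono mult_mono iexp_diff_le exp_minus_diff_le) auto
  finally show ?thesis by simp
qed

text \<open>Three errors add up: the possible descent at the border of the sorted part, the Gaussian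
  approximation for the prefix, and the shift from k = m - 1 to m in mean and variance.\<close>

lemma char_random_prefix_approx:
  assumes m: "m \<le> n" and n: "n > 0"
  shows "cmod (measure_pmf.expectation (pmf_of_set (permutations_of_set {1..n}))
             (\<lambda>xs. iexp (s * ((real (list_descents (sort_from m xs)) - b) / sqrt n)))
           - iexp (s * ((real m / 2 - b) / sqrt n)) * exp (- (s\<^sup>2 * real m / (24 * real n))))
         \<le> (\<bar>s\<bar> ^ 3 + s ^ 4 + 4 * s\<^sup>2 + 2 * \<bar>s\<bar>) / sqrt n"
proof -
  define U where "U = pmf_of_set (permutations_of_set {1..n})"
  have finU: "finite (set_pmf U)" by (simp add: U_def)
  define N where "N = sqrt (real n)"
  have N: "N \<ge> 1" "N * N = real n" using n by (auto simp: N_def)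
  define k where "k = m - 1"
  \<comment> \<open>For m = 0 truncated subtraction gives k = 0, hence k + 1 differs from m; for m
    \<ge> 1 they agree.\<close>
  have k: "k < n" "\<bar>real k - real m\<bar> \<le> 1" "\<bar>(real k + 1) - real m\<bar> \<le> 1"
    using m n by (auto simp: k_def of_nat_diff)
  define E1 where "E1 = measure_pmf.expectation U (\<lambda>xs. iexp (s * ((real (list_descents (sort_from m xs)) - b) / N)))"
  define E2 where "E2 = measure_pmf.expectation U (\<lambda>xs. iexp (s * ((real (list_descents (take m xs)) - b) / N)))"
  have "cmod (E1 - E2) \<le> measure_pmf.expectation U (\<lambda>xs. \<bar>s\<bar> / N)"
    unfolding E1_def E2_def
  proof (rule norm_expectation_diff_le[OF finU])
    fix xs
    have "\<bar>real (list_descents (sort_from m xs)) - real (list_descents (take m xs))\<bar> \<le> 1"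
      using list_descents_append_sorted[of "sort (drop m xs)" "take m xs"] by (auto simp: sort_from_def)
    then have "\<bar>s\<bar> / N * \<bar>real (list_descents (sort_from m xs)) - real (list_descents (take m xs))\<bar> \<le> \<bar>s\<bar> / N * 1"
      using N by (intro mult_left_mono) auto
    moreover have "s * ((real (list_descents (sort_from m xs)) - b) / N) - s * ((real (list_descents (take m xs)) - b) / N)
        = s / N * (real (list_descents (sort_from m xs)) - real (list_descents (take m xs)))"
      by (simp add: right_diff_distrib diff_divide_distrib)
    then have "\<bar>s * ((real (list_descents (sort_from m xs)) - b) / N) - s * ((real (list_descents (take m xs)) - b) / N)\<bar>
        = \<bar>s\<bar> / N * \<bar>real (list_descents (sort_from m xs)) - real (list_descents (take m xs))\<bar>"
      using N by (simp only: abs_mult abs_divide)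
    ultimately show "cmod (iexp (s * ((real (list_descents (sort_from m xs)) - b) / N))
        - iexp (s * ((real (list_descents (take m xs)) - b) / N))) \<le> \<bar>s\<bar> / N"
      by (intro order_trans[OF iexp_diff_le]) simp
  qed
  then have 1: "cmod (E1 - E2) \<le> \<bar>s\<bar> / N" by simp
  define F where "F = measure_pmf.expectation (eulerian k) (\<lambda>x. iexp (s / N * (real x - real k / 2)))"
  have "E2 = measure_pmf.expectation (map_pmf (\<lambda>xs. list_descents (take m xs)) U) (\<lambda>x. iexp (s * ((real x - b) / N)))"
    by (simp add: E2_def)
  also have "map_pmf (\<lambda>xs. list_descents (take m xs)) U = eulerian k"
    unfolding U_def k_def using m by (intro list_descents_take_random_permutation) auto
  also have "measure_pmf.expectation (eulerian k) (\<lambda>x. iexp (s * ((real x - b) / N)))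
      = measure_pmf.expectation (eulerian k) (\<lambda>x. iexp (s * ((real k / 2 - b) / N)) * iexp (s / N * (real x - real k / 2)))"
  proof (intro Bochner_Integration.integral_cong refl)
    fix x
    have "s * ((real x - b) / N) = s * ((real k / 2 - b) / N) + s / N * (real x - real k / 2)"
      by (simp add: right_diff_distrib diff_divide_distrib)
    then show "iexp (s * ((real x - b) / N)) = iexp (s * ((real k / 2 - b) / N)) * iexp (s / N * (real x - real k / 2))"
      by (simp only: of_real_add distrib_left exp_add)
  qed
  also have "\<dots> = iexp (s * ((real k / 2 - b) / N)) * F"
    unfolding F_def by (rule integral_mult_right_zero)
  finally have E2: "E2 = iexp (s * ((real k / 2 - b) / N)) * F" .
  have "cmod (F - exp (- (s\<^sup>2 * (real k + 1) / (24 * real n)))) \<le> (\<bar>s\<bar> ^ 3 + s ^ 4 + 3 * s\<^sup>2) / N"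
    unfolding F_def N_def by (rule eulerian_char_approx[OF k(1)])
  then have 2: "cmod (E2 - iexp (s * ((real k / 2 - b) / N)) * exp (- (s\<^sup>2 * (real k + 1) / (24 * real n))))
      \<le> (\<bar>s\<bar> ^ 3 + s ^ 4 + 3 * s\<^sup>2) / N"
    unfolding E2 right_diff_distrib[symmetric] norm_mult by simp
  have "cmod (iexp (s * ((real k / 2 - b) / N)) * exp (- (s\<^sup>2 * (real k + 1) / (24 * real n)))
       - iexp (s * ((real m / 2 - b) / N)) * exp (- (s\<^sup>2 * real m / (24 * real n))))
       \<le> \<bar>s * ((real k / 2 - b) / N) - s * ((real m / 2 - b) / N)\<bar>
         + \<bar>s\<^sup>2 * (real k + 1) / (24 * real n) - s\<^sup>2 * real m / (24 * real n)\<bar>"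
    by (rule norm_iexp_mult_diff_le) auto
  also have "s * ((real k / 2 - b) / N) - s * ((real m / 2 - b) / N) = s / (2 * N) * (real k - real m)"
    by (simp add: right_diff_distrib diff_divide_distrib)
  also have "s\<^sup>2 * (real k + 1) / (24 * real n) - s\<^sup>2 * real m / (24 * real n) = s\<^sup>2 / (24 * real n) * ((real k + 1) - real m)"
    by (simp add: right_diff_distrib diff_divide_distrib distrib_left add_divide_distrib)
  also have "\<bar>s / (2 * N) * (real k - real m)\<bar> + \<bar>s\<^sup>2 / (24 * real n) * ((real k + 1) - real m)\<bar>
      \<le> \<bar>s\<bar> / N * 1 + s\<^sup>2 / N * 1"
    unfolding abs_mult
  proof (intro add_mono mult_mono k)
    show "\<bar>s / (2 * N)\<bar> \<le> \<bar>s\<bar> / N" using N by (simp add: field_simps)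
    have "N \<le> 24 * (N * N)" using N mult_left_mono[of 1 N N] by simp
    then show "\<bar>s\<^sup>2 / (24 * real n)\<bar> \<le> s\<^sup>2 / N" using N(1) unfolding N(2)[symmetric]
      by (auto simp: abs_mult intro!: divide_left_mono mult_pos_pos)
  qed (use N in auto)
  finally have 3: "cmod (iexp (s * ((real k / 2 - b) / N)) * exp (- (s\<^sup>2 * (real k + 1) / (24 * real n)))
       - iexp (s * ((real m / 2 - b) / N)) * exp (- (s\<^sup>2 * real m / (24 * real n)))) \<le> \<bar>s\<bar> / N + s\<^sup>2 / N"
    by simp
  from norm_diff_triangle_le[OF norm_diff_triangle_le[OF 1 2] 3]
  have "cmod (E1 - iexp (s * ((real m / 2 - b) / N)) * exp (- (s\<^sup>2 * real m / (24 * real n))))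
      \<le> (\<bar>s\<bar> ^ 3 + s ^ 4 + 4 * s\<^sup>2 + 2 * \<bar>s\<bar>) / N"
    by (simp add: add_divide_distrib)
  then show ?thesis unfolding E1_def U_def N_def .
qed

lemma char_normalized_descents_law_approx:
  assumes n: "n > 0"
  shows "cmod (char (normalized_descents_law r n b) s
           - measure_pmf.expectation (occupancy n r)
               (\<lambda>m. iexp (s * ((real m / 2 - b) / sqrt n)) * exp (- (s\<^sup>2 * real m / (24 * real n)))))
         \<le> (\<bar>s\<bar> ^ 3 + s ^ 4 + 4 * s\<^sup>2 + 2 * \<bar>s\<bar>) / sqrt n"
proof -
  have "cmod (char (normalized_descents_law r n b) s
           - measure_pmf.expectation (occupancy n r)
               (\<lambda>m. iexp (s * ((real m / 2 - b) / sqrt n)) * exp (- (s\<^sup>2 * real m / (24 * real n)))))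
      \<le> measure_pmf.expectation (occupancy n r) (\<lambda>m. (\<bar>s\<bar> ^ 3 + s ^ 4 + 4 * s\<^sup>2 + 2 * \<bar>s\<bar>) / sqrt n)"
    unfolding char_normalized_descents_law[OF n]
    by (intro norm_expectation_diff_le char_random_prefix_approx n occupancy_le[OF n]) auto
  then show ?thesis by simp
qed

section \<open>The normal limit law\<close>

lemma prob_space_normal_distribution: "v > 0 \<Longrightarrow> prob_space (normal_distribution 0 v)"
  unfolding normal_distribution_def by (rule prob_space_normal_density) simp

lemma real_distribution_normal_distribution:
  assumes "v > 0"
  shows "real_distribution (normal_distribution 0 v)"
proof -
  interpret prob_space "normal_distribution 0 v" by (rule prob_space_normal_distribution[OF assms])
  show ?thesis by unfold_locales (auto simp: normal_distribution_def)
qed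

lemma char_normal_distribution:
  assumes v: "v > 0"
  shows "char (normal_distribution 0 v) s = exp (- (s\<^sup>2 * v / 2))"
proof -
  interpret prob_space "normal_distribution 0 v" by (rule prob_space_normal_distribution[OF v])
  have "distributed (normal_distribution 0 v) lborel (\<lambda>x. x) (normal_density 0 (sqrt v))"
    unfolding distributed_def normal_distribution_def by (auto simp: distr_id2)
  then have "distributed (normal_distribution 0 v) lborel (\<lambda>x. (x - 0) / sqrt v) std_normal_density"
    using normal_standard_normal_convert[of "sqrt v" "\<lambda>x. x" 0] v by simp
  then have std: "distr (normal_distribution 0 v) lborel (\<lambda>x. x / sqrt v) = std_normal_distribution"
    by (auto simp: distributed_def)
  have "char std_normal_distribution (s * sqrt v) = char (normal_distribution 0 v) s"
    unfolding char_def std[symmetric]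
    by (subst integral_distr) (use v in \<open>auto simp: normal_distribution_def\<close>)
  then show ?thesis
    using v by (simp add: char_std_normal_distribution power_mult_distrib)
qed

section \<open>Linearly many shuffles\<close>

text \<open>M enters twice. In the variance M / 12 it can be replaced by its mean, because its
  fluctuations are of smaller order than n. In the mean M / 2 its fluctuations survive and yield the
  occupancy characteristic function at s / 2.\<close>

lemma char_normalized_descents_law_gaussian_approx:
  fixes s K b :: real
  defines "q \<equiv> \<lambda>n. 1 - 1 / real n"
  assumes n: "n \<ge> 2" and r: "real r \<le> K * real n"
  shows "cmod (char (normalized_descents_law r n b) s
           - iexp (s * ((real n * (1 - q n ^ r) / 2 - b) / sqrt n)) * exp (- (s\<^sup>2 * (1 - q n ^ r) / 24))
             * exp (- ((s / 2)\<^sup>2 * (((q n ^ r - q n ^ (2 * r)) / q n - real r / real n * q n ^ (2 * r) / (q n)\<^sup>2)) / 2)))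
         \<le> ((\<bar>s\<bar> ^ 3 + s ^ 4 + 4 * s\<^sup>2 + 2 * \<bar>s\<bar>) + s\<^sup>2 * sqrt K
            + (K * (\<bar>s / 2\<bar> ^ 3 + (s / 2) ^ 4) + K * sqrt K * (s / 2)\<^sup>2)) / sqrt n"
proof -
  have n0: "n > 0" using n by simp
  interpret occ: linear_bernoulli_chain "\<lambda>k. 1" "\<lambda>k. 1 / real n"
    by (rule linear_bernoulli_chain_occupancy[OF n0])
  define N where "N = sqrt (real n)"
  have N: "N \<ge> 1" "N * N = real n" using n by (auto simp: N_def)
  define a where "a = 1 - q n ^ r"
  have a: "0 \<le> a" using n by (auto simp: a_def q_def intro!: power_le_one)
  have mean: "occ.\<mu> r = real n * a"
    unfolding a_def q_def by (rule occupancy_mean[OF n0])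
  define G where "G = exp (- ((s / 2)\<^sup>2 * (((q n ^ r - q n ^ (2 * r)) / q n - real r / real n * q n ^ (2 * r) / (q n)\<^sup>2)) / 2))"
  define E1 where "E1 = measure_pmf.expectation (occupancy n r)
      (\<lambda>m. iexp (s * ((real m / 2 - b) / N)) * exp (- (s\<^sup>2 * real m / (24 * real n))))"
  define E2 where "E2 = measure_pmf.expectation (occupancy n r)
      (\<lambda>m. iexp (s * ((real m / 2 - b) / N)) * exp (- (s\<^sup>2 * a / 24)))"
  have 1: "cmod (char (normalized_descents_law r n b) s - E1) \<le> (\<bar>s\<bar> ^ 3 + s ^ 4 + 4 * s\<^sup>2 + 2 * \<bar>s\<bar>) / N"
    unfolding E1_def N_def by (rule char_normalized_descents_law_approx[OF n0])
  have "cmod (E1 - E2) \<le> measure_pmf.expectation (occupancy n r) (\<lambda>m. s\<^sup>2 / (24 * real n) * \<bar>real m - real n * a\<bar>)"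
    unfolding E1_def E2_def
  proof (rule norm_expectation_diff_le)
    fix m :: nat
    have "s\<^sup>2 * real m / (24 * real n) - s\<^sup>2 * a / 24 = s\<^sup>2 / (24 * real n) * (real m - real n * a)"
      using n0 by (simp add: field_simps)
    then have "\<bar>s\<^sup>2 * real m / (24 * real n) - s\<^sup>2 * a / 24\<bar> = s\<^sup>2 / (24 * real n) * \<bar>real m - real n * a\<bar>"
      by (simp add: abs_mult)
    moreover have "cmod (iexp (s * ((real m / 2 - b) / N)) * exp (- (s\<^sup>2 * real m / (24 * real n)))
        - iexp (s * ((real m / 2 - b) / N)) * exp (- (s\<^sup>2 * a / 24)))
        \<le> \<bar>s * ((real m / 2 - b) / N) - s * ((real m / 2 - b) / N)\<bar> + \<bar>s\<^sup>2 * real m / (24 * real n) - s\<^sup>2 * a / 24\<bar>"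
      by (rule norm_iexp_mult_diff_le) (use a in auto)
    ultimately show "cmod (iexp (s * ((real m / 2 - b) / N)) * exp (- (s\<^sup>2 * real m / (24 * real n)))
        - iexp (s * ((real m / 2 - b) / N)) * exp (- (s\<^sup>2 * a / 24))) \<le> s\<^sup>2 / (24 * real n) * \<bar>real m - real n * a\<bar>"
      by linarith
  qed simp
  also have "\<dots> = s\<^sup>2 / (24 * real n) * measure_pmf.expectation (occupancy n r) (\<lambda>m. \<bar>real m - real n * a\<bar>)"
    by simp
  also have "\<dots> \<le> s\<^sup>2 / (24 * real n) * (sqrt K * N)"
  proof (rule mult_left_mono)
    have "sqrt (real r) \<le> sqrt K * N" using r by (simp add: N_def flip: real_sqrt_mult)
    then show "measure_pmf.expectation (occupancy n r) (\<lambda>m. \<bar>real m - real n * a\<bar>) \<le> sqrt K * N"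
      using occ.mean_abs_deviation_le[of r] by (simp add: mean)
  qed simp
  also have "\<dots> = s\<^sup>2 * sqrt K / N / 24"
    using N(1) by (simp flip: N(2))
  also have "\<dots> \<le> s\<^sup>2 * sqrt K / N"
  proof -
    have "0 \<le> K * real n" using r by (rule order_trans[rotated]) simp
    then have "0 \<le> K" using n0 by (simp add: zero_le_mult_iff)
    then show ?thesis using N(1) by (simp add: field_simps)
  qed
  finally have 2: "cmod (E1 - E2) \<le> s\<^sup>2 * sqrt K / N" .
  define z where "z = iexp (s * ((real n * a / 2 - b) / N)) * exp (- (s\<^sup>2 * a / 24))"
  define H where "H = measure_pmf.expectation (occupancy n r) (\<lambda>m. iexp ((s / 2) / N * (real m - real n * a)))"
  have "E2 = measure_pmf.expectation (occupancy n r) (\<lambda>m. z * iexp ((s / 2) / N * (real m - real n * a)))"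
    unfolding E2_def
  proof (intro Bochner_Integration.integral_cong refl)
    fix m :: nat
    have "s * ((real m / 2 - b) / N) = s * ((real n * a / 2 - b) / N) + (s / 2) / N * (real m - real n * a)"
      using N(1) by (simp add: field_simps)
    then have "iexp (s * ((real m / 2 - b) / N)) = iexp (s * ((real n * a / 2 - b) / N)) * iexp ((s / 2) / N * (real m - real n * a))"
      by (simp only: of_real_add distrib_left exp_add)
    then show "iexp (s * ((real m / 2 - b) / N)) * exp (- (s\<^sup>2 * a / 24)) = z * iexp ((s / 2) / N * (real m - real n * a))"
      by (simp only: z_def mult_ac)
  qed
  also have "\<dots> = z * H"
    unfolding H_def by (rule integral_mult_right_zero)
  finally have E2: "E2 = z * H" .
  have H: "cmod (H - G) \<le> (K * (\<bar>s / 2\<bar> ^ 3 + (s / 2) ^ 4) + K * sqrt K * (s / 2)\<^sup>2) / N"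
    unfolding H_def G_def N_def a_def q_def by (rule occupancy_char_approx[OF n r])
  have "cmod z \<le> 1" using a by (simp add: z_def norm_mult)
  then have "cmod z * cmod (H - G) \<le> 1 * cmod (H - G)"
    by (intro mult_right_mono) auto
  then have 3: "cmod (E2 - z * G) \<le> (K * (\<bar>s / 2\<bar> ^ 3 + (s / 2) ^ 4) + K * sqrt K * (s / 2)\<^sup>2) / N"
    using H unfolding E2 right_diff_distrib[symmetric] norm_mult by linarith
  from norm_diff_triangle_le[OF norm_diff_triangle_le[OF 1 2] 3] show ?thesis
    unfolding z_def G_def N_def a_def add_divide_distrib .
qed

text \<open>The centring in (i) uses exp (- c) instead of the exact mean, and the mismatch is
  magnified by sqrt n, so mere convergence of the power is not enough. The floor is handled by the
  exponents c n - 1 and c n, for which the difference from exp (- c) is still O(1 / n).\<close>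

lemma sqrt_mult_power_minus_exp_tendsto_0:
  fixes c :: real
  assumes c: "c > 0"
  shows "(\<lambda>n. sqrt (real n) * ((1 - 1 / real n) ^ nat \<lfloor>c * real n\<rfloor> - exp (- c))) \<longlonglongrightarrow> 0"
proof (rule real_tendsto_sandwich)
  show "(\<lambda>n. sqrt (real n) * ((1 - 1 / real n) powr (c * real n) - exp (- c))) \<longlonglongrightarrow> 0"
    using c by real_asymp
  show "(\<lambda>n. sqrt (real n) * ((1 - 1 / real n) powr (c * real n - 1) - exp (- c))) \<longlonglongrightarrow> 0"
    using c by real_asymp
  have bounds: "(1 - 1 / real n) powr (c * real n) \<le> (1 - 1 / real n) ^ nat \<lfloor>c * real n\<rfloor>
      \<and> (1 - 1 / real n) ^ nat \<lfloor>c * real n\<rfloor> \<le> (1 - 1 / real n) powr (c * real n - 1)" if "n \<ge> 2" for n :: nat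
  proof -
    have q: "0 < 1 - 1 / real n" "1 - 1 / real n \<le> 1" using that by auto
    have "real (nat \<lfloor>c * real n\<rfloor>) = of_int \<lfloor>c * real n\<rfloor>" using c by simp
    then have "real (nat \<lfloor>c * real n\<rfloor>) \<le> c * real n" "c * real n - 1 \<le> real (nat \<lfloor>c * real n\<rfloor>)"
      by linarith+
    then show ?thesis
      unfolding powr_realpow[OF q(1), symmetric] using q by (auto intro!: powr_mono')
  qed
  show "\<forall>\<^sub>F n in sequentially. sqrt (real n) * ((1 - 1 / real n) powr (c * real n) - exp (- c))
      \<le> sqrt (real n) * ((1 - 1 / real n) ^ nat \<lfloor>c * real n\<rfloor> - exp (- c))"
    using eventually_ge_at_top[of 2] by eventually_elim (use bounds in \<open>auto intro!: mult_left_mono\<close>)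
  show "\<forall>\<^sub>F n in sequentially. sqrt (real n) * ((1 - 1 / real n) ^ nat \<lfloor>c * real n\<rfloor> - exp (- c))
      \<le> sqrt (real n) * ((1 - 1 / real n) powr (c * real n - 1) - exp (- c))"
    using eventually_ge_at_top[of 2] by eventually_elim (use bounds in \<open>auto intro!: mult_left_mono\<close>)
qed

text \<open>With e = exp (- c), the inequality 1 + c \<le> exp c gives 3 (1 + c) e^2 \<le> 3 e < 1 +
  2 e. Positivity is needed for the limit to be a genuine normal law.\<close>

lemma descents_variance_pos:
  fixes c :: real
  assumes "c > 0"
  shows "(1 + 2 * exp (- c) - 3 * (1 + c) * exp (- 2 * c)) / 12 > 0"
proof -
  define e where "e = exp (- c)"
  have e: "0 < e" "e < 1" "exp (- 2 * c) = e * e"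
    using assms by (auto simp: e_def simp flip: exp_add)
  have "(1 + c) * e \<le> exp c * e"
    using exp_ge_add_one_self[of c] e by (intro mult_right_mono) auto
  also have "\<dots> = 1" by (simp add: e_def exp_minus)
  finally have "(1 + c) * e * e \<le> 1 * e" using e by (intro mult_right_mono) auto
  then have "3 * ((1 + c) * (e * e)) < 1 + 2 * e" using e by (simp only: mult.assoc)
  then have "0 < 1 + 2 * e - 3 * (1 + c) * (e * e)" unfolding mult.assoc by linarith
  then show ?thesis unfolding e(3) e_def[symmetric] by (intro divide_pos_pos) auto
qed

lemma weak_conv_descents_linear:
  fixes c :: real
  assumes c: "c > 0"
  shows "weak_conv_m
           (\<lambda>n. normalized_descents_law (nat \<lfloor>c * real n\<rfloor>) n (real n * (1 - exp (- c)) / 2))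
           (normal_distribution 0 ((1 + 2 * exp (- c) - 3 * (1 + c) * exp (- 2 * c)) / 12))"
proof (rule levy_continuity)
  define v where "v = (1 + 2 * exp (- c) - 3 * (1 + c) * exp (- 2 * c)) / 12"
  have v: "v > 0" unfolding v_def by (rule descents_variance_pos[OF c])
  define r where "r n = nat \<lfloor>c * real n\<rfloor>" for n
  define b where "b n = real n * (1 - exp (- c)) / 2" for n :: nat
  define q where "q n = 1 - 1 / real n" for n :: nat
  define C where "C s = ((\<bar>s\<bar> ^ 3 + s ^ 4 + 4 * s\<^sup>2 + 2 * \<bar>s\<bar>) + s\<^sup>2 * sqrt c
            + (c * (\<bar>s / 2\<bar> ^ 3 + (s / 2) ^ 4) + c * sqrt c * (s / 2)\<^sup>2))" for s :: real
  fix s :: real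
  define F where "F n = iexp (s * ((real n * (1 - q n ^ r n) / 2 - b n) / sqrt n)) * exp (- (s\<^sup>2 * (1 - q n ^ r n) / 24))
      * exp (- ((s / 2)\<^sup>2 * (((q n ^ r n - q n ^ (2 * r n)) / q n - real (r n) / real n * q n ^ (2 * r n) / (q n)\<^sup>2)) / 2))" for n
  have approx: "(\<lambda>n. char (normalized_descents_law (r n) n (b n)) s - F n) \<longlonglongrightarrow> 0"
  proof (rule Lim_null_comparison)
    show "\<forall>\<^sub>F n in sequentially. cmod (char (normalized_descents_law (r n) n (b n)) s - F n) \<le> C s / sqrt n"
      using eventually_ge_at_top[of 2]
    proof eventually_elim
      case (elim n)
      have "real (r n) \<le> c * real n" using c by (simp add: r_def)
      from char_normalized_descents_law_gaussian_approx[OF elim this] show ?case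
        unfolding F_def q_def C_def .
    qed
    show "(\<lambda>n. C s / sqrt (real n)) \<longlonglongrightarrow> 0" by real_asymp
  qed
  have L0: "(\<lambda>n. sqrt (real n) * (q n ^ r n - exp (- c))) \<longlonglongrightarrow> 0"
    unfolding q_def r_def by (rule sqrt_mult_power_minus_exp_tendsto_0[OF c])
  have L1: "(\<lambda>n. q n ^ r n) \<longlonglongrightarrow> exp (- c)"
  proof -
    have "(\<lambda>n. 1 / sqrt (real n)) \<longlonglongrightarrow> 0" by real_asymp
    from tendsto_add[OF tendsto_mult[OF this L0] tendsto_const[of "exp (- c)"]]
    have "(\<lambda>n. 1 / sqrt (real n) * (sqrt (real n) * (q n ^ r n - exp (- c))) + exp (- c)) \<longlonglongrightarrow> exp (- c)"
      by simp
    then show ?thesis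
      by (rule Lim_transform_eventually) (use eventually_gt_at_top[of 0] in \<open>eventually_elim, simp\<close>)
  qed
  have L2: "(\<lambda>n. real (r n) / real n) \<longlonglongrightarrow> c"
    unfolding r_def using c by real_asymp
  have L3: "q \<longlonglongrightarrow> 1"
    unfolding q_def by real_asymp
  have L4: "(\<lambda>n. q n ^ (2 * r n)) \<longlonglongrightarrow> (exp (- c))\<^sup>2"
    using tendsto_power[OF L1, of 2] by (simp add: power_mult[symmetric] mult.commute)
  \<comment> \<open>The phase left over by centring at the limit value instead of the exact mean; it
    vanishes by the rate in \<open>L0\<close>.\<close>
  have L5: "(\<lambda>n. s * ((real n * (1 - q n ^ r n) / 2 - b n) / sqrt n)) \<longlonglongrightarrow> 0"
  proof -
    have "(\<lambda>n. - (s / 2) * (sqrt (real n) * (q n ^ r n - exp (- c)))) \<longlonglongrightarrow> - (s / 2) * 0"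
      by (intro tendsto_intros L0)
    moreover have "- (s / 2) * (sqrt (real n) * (q n ^ r n - exp (- c)))
        = s * ((real n * (1 - q n ^ r n) / 2 - b n) / sqrt n)" for n
    proof -
      have "real n * (1 - q n ^ r n) / 2 - b n = - (real n * (q n ^ r n - exp (- c))) / 2"
        by (simp add: b_def field_simps)
      then have "s * ((real n * (1 - q n ^ r n) / 2 - b n) / sqrt n)
          = - (s / 2) * (real n / sqrt (real n) * (q n ^ r n - exp (- c)))"
        by simp
      then show ?thesis by (simp only: real_div_sqrt[OF of_nat_0_le_iff])
    qed
    ultimately show ?thesis by simp
  qed
  have "F \<longlonglongrightarrow> iexp 0 * exp (- (s\<^sup>2 * (1 - exp (- c)) / 24))
      * exp (- ((s / 2)\<^sup>2 * ((exp (- c) - (exp (- c))\<^sup>2) / 1 - c * (exp (- c))\<^sup>2 / 1\<^sup>2) / 2))"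
    unfolding F_def
    by (intro tendsto_intros L1 L2 L3 L4 L5) auto
  also have "iexp 0 * exp (- (s\<^sup>2 * (1 - exp (- c)) / 24))
      * exp (- ((s / 2)\<^sup>2 * ((exp (- c) - (exp (- c))\<^sup>2) / 1 - c * (exp (- c))\<^sup>2 / 1\<^sup>2) / 2))
      = complex_of_real (exp (- (s\<^sup>2 * v / 2)))"
  proof -
    have e2: "exp (- 2 * c) = (exp (- c))\<^sup>2" by (simp add: power2_eq_square flip: exp_add)
    \<comment> \<open>With e = exp (- c): (1 - e) / 12 from the permutation and (e - e^2 - c e^2) /
      4 from the number of distinct cards together give v.\<close>
    have "- (s\<^sup>2 * v / 2) = - (s\<^sup>2 * (1 - exp (- c)) / 24)
        + - ((s / 2)\<^sup>2 * ((exp (- c) - (exp (- c))\<^sup>2) / 1 - c * (exp (- c))\<^sup>2 / 1\<^sup>2) / 2)"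
      unfolding v_def e2 by (simp add: field_simps)
    then show ?thesis by (simp only: exp_add of_real_mult) simp
  qed
  also have "\<dots> = char (normal_distribution 0 v) s"
    using char_normal_distribution[OF v] by simp
  finally have "F \<longlonglongrightarrow> char (normal_distribution 0 v) s" .
  from tendsto_add[OF approx this]
  show "(\<lambda>n. char (normalized_descents_law (nat \<lfloor>c * real n\<rfloor>) n (real n * (1 - exp (- c)) / 2)) s)
      \<longlonglongrightarrow> char (normal_distribution 0 ((1 + 2 * exp (- c) - 3 * (1 + c) * exp (- 2 * c)) / 12)) s"
    by (simp add: r_def b_def v_def)
qed (use descents_variance_pos[OF c] in \<open>auto intro!: real_distribution_normalized_descents_law real_distribution_normal_distribution\<close>)

section \<open>Shuffling beyond n log n / 2\<close>

text \<open>Replacing M by n changes phase and variance by amounts linear in n - M, so only the mean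
  of n - M is needed, and this is known exactly for every r.\<close>

lemma char_normalized_descents_law_uniform_approx:
  assumes n: "n > 0"
  shows "cmod (char (normalized_descents_law r n (real n / 2)) s - exp (- (s\<^sup>2 / 24)))
      \<le> (\<bar>s\<bar> ^ 3 + s ^ 4 + 4 * s\<^sup>2 + 2 * \<bar>s\<bar>) / sqrt n + (\<bar>s\<bar> + s\<^sup>2) * (sqrt n * (1 - 1 / real n) ^ r)"
proof -
  interpret occ: linear_bernoulli_chain "\<lambda>k. 1" "\<lambda>k. 1 / real n"
    by (rule linear_bernoulli_chain_occupancy[OF n])
  define N where "N = sqrt (real n)"
  have N: "N \<ge> 1" "N * N = real n" using n by (auto simp: N_def)
  define E1 where "E1 = measure_pmf.expectation (occupancy n r)
      (\<lambda>m. iexp (s * ((real m / 2 - real n / 2) / N)) * exp (- (s\<^sup>2 * real m / (24 * real n))))"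
  have 1: "cmod (char (normalized_descents_law r n (real n / 2)) s - E1) \<le> (\<bar>s\<bar> ^ 3 + s ^ 4 + 4 * s\<^sup>2 + 2 * \<bar>s\<bar>) / N"
    unfolding E1_def N_def by (rule char_normalized_descents_law_approx[OF n])
  have "cmod (E1 - measure_pmf.expectation (occupancy n r) (\<lambda>m. iexp 0 * exp (- (s\<^sup>2 / 24))))
      \<le> measure_pmf.expectation (occupancy n r) (\<lambda>m. (\<bar>s\<bar> + s\<^sup>2) / N * (real n - real m))"
    unfolding E1_def
  proof (rule norm_expectation_diff_le)
    fix m assume "m \<in> set_pmf (occupancy n r)"
    then have m: "0 \<le> real n - real m" using occupancy_le[OF n] by simp
    have "cmod (iexp (s * ((real m / 2 - real n / 2) / N)) * exp (- (s\<^sup>2 * real m / (24 * real n))) - iexp 0 * exp (- (s\<^sup>2 / 24)))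
        \<le> \<bar>s * ((real m / 2 - real n / 2) / N) - 0\<bar> + \<bar>s\<^sup>2 * real m / (24 * real n) - s\<^sup>2 / 24\<bar>"
      by (rule norm_iexp_mult_diff_le) auto
    also have "s * ((real m / 2 - real n / 2) / N) - 0 = - (s / (2 * N)) * (real n - real m)"
      using N(1) by (simp add: field_simps)
    also have "s\<^sup>2 * real m / (24 * real n) - s\<^sup>2 / 24 = - (s\<^sup>2 / (24 * real n)) * (real n - real m)"
      using n by (simp add: field_simps)
    also have "\<bar>- (s / (2 * N)) * (real n - real m)\<bar> + \<bar>- (s\<^sup>2 / (24 * real n)) * (real n - real m)\<bar>
        = (\<bar>s\<bar> / (2 * N) + s\<^sup>2 / (24 * real n)) * (real n - real m)"
      using m N(1) by (simp add: abs_mult distrib_right)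
    also have "\<dots> \<le> (\<bar>s\<bar> / N + s\<^sup>2 / N) * (real n - real m)"
    proof (intro mult_right_mono add_mono m)
      show "\<bar>s\<bar> / (2 * N) \<le> \<bar>s\<bar> / N" using N(1) by (intro divide_left_mono) auto
      have "N \<le> 24 * (N * N)" using N(1) mult_left_mono[of 1 N N] by simp
      then show "s\<^sup>2 / (24 * real n) \<le> s\<^sup>2 / N"
        using N(1) unfolding N(2)[symmetric] by (intro divide_left_mono mult_pos_pos) auto
    qed
    finally show "cmod (iexp (s * ((real m / 2 - real n / 2) / N)) * exp (- (s\<^sup>2 * real m / (24 * real n)))
        - iexp 0 * exp (- (s\<^sup>2 / 24))) \<le> (\<bar>s\<bar> + s\<^sup>2) / N * (real n - real m)"
      by (simp add: add_divide_distrib)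
  qed simp
  also have "\<dots> = (\<bar>s\<bar> + s\<^sup>2) / N * (real n - occ.\<mu> r)"
    by (simp only: integral_mult_right_zero Bochner_Integration.integral_diff[OF occ.integrable occ.integrable]
          occ.expectation_id) simp
  also have "real n - occ.\<mu> r = real n * (1 - 1 / real n) ^ r"
    unfolding occupancy_mean[OF n] by (simp add: right_diff_distrib)
  also have "(\<bar>s\<bar> + s\<^sup>2) / N * (real n * (1 - 1 / real n) ^ r) = (\<bar>s\<bar> + s\<^sup>2) * (N * (1 - 1 / real n) ^ r)"
  proof -
    have "(\<bar>s\<bar> + s\<^sup>2) / N * (N * N * x) = (\<bar>s\<bar> + s\<^sup>2) * (N * x)" for x
      using N(1) by simp
    then show ?thesis unfolding N(2) .
  qed
  finally have 2: "cmod (E1 - exp (- (s\<^sup>2 / 24))) \<le> (\<bar>s\<bar> + s\<^sup>2) * (N * (1 - 1 / real n) ^ r)"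
    by simp
  from norm_diff_triangle_le[OF 1 2] show ?thesis unfolding N_def .
qed

text \<open>By 1 - 1 / n \<le> exp (- 1 / n), the mean number of untouched cards is at most n exp (-
  r / n). It only has to be o(sqrt n), not o(1), and hence half of the coupon collector time n log n
  suffices.\<close>

lemma weak_conv_descents_mixed:
  fixes r :: "nat \<Rightarrow> nat" and \<gamma> :: "nat \<Rightarrow> real"
  assumes \<gamma>: "filterlim \<gamma> at_top sequentially"
    and r: "\<forall>\<^sub>F n in sequentially. real (r n) \<ge> real n * ln (real n) / 2 + \<gamma> n * real n"
  shows "weak_conv_m (\<lambda>n. normalized_descents_law (r n) n (real n / 2)) (normal_distribution 0 (1 / 12))"
proof (rule levy_continuity)
  fix s :: real
  define C where "C = \<bar>s\<bar> ^ 3 + s ^ 4 + 4 * s\<^sup>2 + 2 * \<bar>s\<bar>"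
  have "(\<lambda>n. char (normalized_descents_law (r n) n (real n / 2)) s - exp (- (s\<^sup>2 / 24))) \<longlonglongrightarrow> 0"
  proof (rule Lim_null_comparison)
    show "\<forall>\<^sub>F n in sequentially. cmod (char (normalized_descents_law (r n) n (real n / 2)) s - exp (- (s\<^sup>2 / 24)))
        \<le> C / sqrt n + (\<bar>s\<bar> + s\<^sup>2) * exp (- \<gamma> n)"
      using r eventually_gt_at_top[of 0]
    proof eventually_elim
      case (elim n)
      have "(1 - 1 / real n) ^ r n \<le> exp (- (1 / real n)) ^ r n"
        using elim(2) exp_ge_add_one_self[of "- (1 / real n)"] by (intro power_mono) auto
      also have "\<dots> = exp (- (real (r n) / real n))"
        by (simp add: exp_of_nat_mult[symmetric])
      also have "\<dots> \<le> exp (- (ln (real n) / 2 + \<gamma> n))"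
        using elim by (simp add: field_simps)
      also have "\<dots> = exp (- \<gamma> n) / sqrt n"
      proof -
        have "sqrt (real n) = exp (ln (real n) / 2)"
          using elim(2) by (simp add: ln_sqrt[symmetric])
        then show ?thesis by (simp add: exp_diff exp_minus field_simps flip: exp_add)
      qed
      finally have "sqrt n * (1 - 1 / real n) ^ r n \<le> exp (- \<gamma> n)"
        using elim(2) by (simp add: field_simps)
      then have "(\<bar>s\<bar> + s\<^sup>2) * (sqrt n * (1 - 1 / real n) ^ r n) \<le> (\<bar>s\<bar> + s\<^sup>2) * exp (- \<gamma> n)"
        by (intro mult_left_mono) auto
      with char_normalized_descents_law_uniform_approx[OF elim(2), of "r n" s] show ?case
        unfolding C_def by linarith
    qed
    have "((\<lambda>n. exp (- \<gamma> n)) \<longlonglongrightarrow> 0)"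
      by (rule filterlim_compose[OF exp_at_bot]) (use \<gamma> in \<open>simp add: filterlim_uminus_at_bot\<close>)
    moreover have "(\<lambda>n. C / sqrt (real n)) \<longlonglongrightarrow> 0" by real_asymp
    ultimately show "(\<lambda>n. C / sqrt (real n) + (\<bar>s\<bar> + s\<^sup>2) * exp (- \<gamma> n)) \<longlonglongrightarrow> 0"
      using tendsto_add[OF _ tendsto_mult_left, of _ 0 sequentially _ 0 "\<bar>s\<bar> + s\<^sup>2"] by simp
  qed
  from tendsto_add[OF this tendsto_const[of "complex_of_real (exp (- (s\<^sup>2 / 24)))"]]
  have "(\<lambda>n. char (normalized_descents_law (r n) n (real n / 2)) s) \<longlonglongrightarrow> exp (- (s\<^sup>2 / 24))"
    by simp
  then show "(\<lambda>n. char (normalized_descents_law (r n) n (real n / 2)) s) \<longlonglongrightarrow> char (normal_distribution 0 (1 / 12)) s"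
    by (simp add: char_normal_distribution)
qed (auto intro!: real_distribution_normalized_descents_law real_distribution_normal_distribution)

theorem theorem1p2:
  shows "(\<forall>c::real. c > 0 \<longrightarrow>
            weak_conv_m
              (\<lambda>n. normalized_descents_law (nat \<lfloor>c * real n\<rfloor>) n (real n * (1 - exp (- c)) / 2))
              (normal_distribution 0
                 ((1 + 2 * exp (- c) - 3 * (1 + c) * exp (- 2 * c)) / 12)))
       \<and> (\<forall>r :: nat \<Rightarrow> nat.
            (\<forall>n\<ge>1. r n > 0) \<and>
            (\<exists>\<gamma> :: nat \<Rightarrow> real. filterlim \<gamma> at_top sequentially \<and>
               (\<forall>\<^sub>F n in sequentially.
                  real (r n) \<ge> real n * ln (real n) / 2 + \<gamma> n * real n))
            \<longrightarrow> weak_conv_m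
                  (\<lambda>n. normalized_descents_law (r n) n (real n / 2))
                  (normal_distribution 0 (1 / 12)))"
  using weak_conv_descents_linear weak_conv_descents_mixed by blast

end
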